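(* Let $(\mathbb{G}^N)_{N\in\mathbb{N}}$ be a sequence of games as described in the context, with horizon $T\in\mathbb{N}\cup\{\infty\}$, satisfying conditions (A1)–(A3) listed in the context. Then, given $\epsilon>0$, there exists $\bar N_\epsilon\in\mathbb{N}$ such that, if $N\ge\bar N_\epsilon$, then any SEBEU in mixed strategies $\gamma^{*,N}=(\gamma^{1,N},\dots,\gamma^{N,N})$ in $\mathbb{G}^N$ is also an $\epsilon$-Nash equilibrium in $\mathbb{G}^N$, i.e. $$E^{\gamma^{*,N}}[\bar J^{i,N}]\le E^{(\tilde\gamma^i,\gamma^{-i,N})}[\bar J^{i,N}]+\epsilon,\qquad\forall\, i\in[1,N],\ \tilde\gamma^i\in\Gamma^i,$$ where $\gamma^{-i,N}=(\gamma^{j,N})_{j\in[1,N]\setminus\{i\}}$.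
   Context: Notation: $[1,N]=\{1,\dots,N\}$, $[0,T)=\{0,\dots,T-1\}$ if $T\in\mathbb{N}$ and $[0,T)=\mathbb{N}_0$ if $T=\infty$. $\mathcal{P}(\mathbb{T})$ is the set of Borel probability measures on $\mathbb{T}$; $m_{\mathbb{M}}$ is the metric of a metric space $\mathbb{M}$. Countable products of metric spaces carry the product metric $m(a,b)=\sum_t2^{-t}\frac{m_t(a_t,b_t)}{1+m_t(a_t,b_t)}$. Games: $\mathbb{G}^N$ has decision makers DM$^1,\dots,$DM$^N$. At time $t$, DM$^i$ has state $x_t^i\in\mathbb{X}^i$, control $u_t^i\in\mathbb{U}^i$, random disturbance $w_t^i\in\mathbb{W}^i$; there is an environment variable $y_t\in\mathbb{Y}$, an environment state $x_t^0\in\mathbb{X}^0$, random disturbances $w_t^0\in\mathbb{W}^0$, $\xi_t\in\Xi$, and aggregate statistics $d_t^N(x_t,u_t)\in\mathbb{D}$, where $d_t^N:\mathbb{X}^1\times\cdots\times\mathbb{X}^N\times\mathbb{U}^1\times\cdots\times\mathbb{U}^N\to\mathbb{D}$, $x_t=(x_t^1,\dots,x_t^N)$, $u_t=(u_t^1,\dots,u_t^N)$, and $\mathbb{D}$ is a compact metric space. The dynamics for $t\in[0,T)$ are $x_{t+1}^i=f_t^i(x_t^i,u_t^i,y_t,w_t^i)$ for $i\in[1,N]$, $y_t=g_t(x_t^0,d_t^N(x_t,u_t),\xi_t)$, $x_{t+1}^0=f_t^0(x_t^0,d_t^N(x_t,u_t),w_t^0)$, with $g_t:\mathbb{X}^0\times\mathbb{D}\times\Xi\to\mathbb{Y}$,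 $f_t^0:\mathbb{X}^0\times\mathbb{D}\times\mathbb{W}^0\to\mathbb{X}^0$, and possibly random initial states $x_0^0,\dots,x_0^N$. All games share $T,\mathbb{Y},\mathbb{X}^0,\mathbb{D},\mathbb{W}^0,\Xi,(f_t^0)_t,(g_t)_t$ (and the law of the environment's random parameters), and the data of DM$^i$, namely $\mathbb{X}^i,\mathbb{U}^i,\mathbb{W}^i,(f_t^i)_t,(c_t^i)_t,\beta^i,\mathbb{S}^i$ and the law of $(x_0^i,(w_t^i)_{t\in[0,T)})$, is the same in all games $\mathbb{G}^i,\mathbb{G}^{i+1},\dots$; only the maps $d_t^N$ depend on $N$. Strategies: $I_t^i=((x_k^i)_{k\in[0,t]},(u_k^i)_{k\in[0,t)})\in\mathbb{I}_t^i:=(\mathbb{X}^i)^{[0,t]}\times(\mathbb{U}^i)^{[0,t)}$, $Y_{t-1}=(y_k)_{k\in[0,t)}$ ($Y_{-1}=\emptyset$). A pure strategy of DM$^i$ is $s^i=(s_t^i)_{t\in[0,T)}$, $s_t^i:\mathbb{I}_t^i\times\mathbb{Y}^{[0,t)}\to\mathbb{U}^i$, used as $u_t^i=s_t^i(I_t^i,Y_{t-1})$; $\mathbb{S}^i$ is the set of admissible pure strategies. Mixed strategies: $\Gamma^i=\mathcal{P}(\mathbb{S}^i)$; under $\gamma=(\gamma^1,\dots,\gamma^N)\in\Gamma^1\times\cdots\times\Gamma^N$ each DM$^i$ draws $s^i\sim\gamma^i$ independently (of the other DMs and of all primitive random variables) and uses it. Costs: DM$^i$ has discount factor $\beta^i\in(0,1]$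 ($\beta^i\in(0,1)$ if $T=\infty$), stage costs $c_t^i:\mathbb{X}^i\times\mathbb{U}^i\times\mathbb{Y}\to\mathbb{R}$ ($t\in[0,T)$), terminal cost $c_T^i:\mathbb{X}^i\to\mathbb{R}$ ($c_T^i\equiv0$ if $T=\infty$). For a joint pure strategy $s$ in $\mathbb{G}^N$, $\bar J^{i,N}(s)=E[\sum_{t\in[0,T)}(\beta^i)^tc_t^i(x_t^i,u_t^i,y_t)+(\beta^i)^Tc_T^i(x_T^i)]$ under the dynamics of $\mathbb{G}^N$; $E^\gamma[\bar J^{i,N}]$ is its average over $s\sim\gamma$. For $s^i\in\mathbb{S}^i$ and deterministic $\bar Z=(\bar z_t)_t\in\mathbb{Y}^{[0,T)}$, $J^i(s^i,\bar Z)=E[\sum_{t\in[0,T)}(\beta^i)^tc_t^i(x_t^i,u_t^i,\bar z_t)+(\beta^i)^Tc_T^i(x_T^i)]$ where $x_{t+1}^i=f_t^i(x_t^i,u_t^i,\bar z_t,w_t^i)$, $u_t^i=s_t^i(I_t^i,(\bar z_0,\dots,\bar z_{t-1}))$. For $\zeta\in\mathcal{P}(\mathbb{Y}^{[0,T)})$, $E^{(\gamma^i,\zeta)}[J^i]=\int\int J^i(s^i,z)\gamma^i(ds^i)\zeta(dz)$. SEBEU in mixed strategies in $\mathbb{G}^N$: a profile $\gamma=(\gamma^1,\dots,\gamma^N)$ such that $E^{(\gamma^i,\zeta_\gamma)}[J^i]\le E^{(\tilde\gamma^i,\zeta_\gamma)}[J^i]$ for all $i\in[1,N]$, $\tilde\gamma^i\in\Gamma^i$,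 where $\zeta_\gamma\in\mathcal{P}(\mathbb{Y}^{[0,T)})$ is the distribution of $(y_t)_{t\in[0,T)}$ generated in $\mathbb{G}^N$ under $\gamma$. Conditions: (A1) All the spaces $\mathbb{X}^0,\mathbb{W}^0,\mathbb{Y},\Xi$ and $\mathbb{X}^i,\mathbb{U}^i,\mathbb{W}^i$ ($i\in\mathbb{N}$) are nonempty compact metric spaces; all $c_t^i,f_t^i$ ($i\in\mathbb{N}$), $f_t^0$, $g_t$ are continuous; for each $i\in\mathbb{N}$, $\mathbb{S}^i=\times_{t\in[0,T)}\mathbb{S}_t^i$ with each $\mathbb{S}_t^i$ a nonempty compact subset of the space of continuous functions $\mathbb{I}_t^i\times\mathbb{Y}^{[0,t)}\to\mathbb{U}^i$ with the supremum metric. Moreover: (a) for all $i\in\mathbb{N}$, $\mathbb{X}^i=\mathbb{X}^1$, $\mathbb{U}^i=\mathbb{U}^1$, $\mathbb{W}^i=\mathbb{W}^1$, $\mathbb{S}^i=\mathbb{S}^1$; (b) for each $t$, the families $(c_t^i)_{i\in\mathbb{N}}$ and $(f_t^i)_{i\in\mathbb{N}}$ are uniformly equi-continuous; (c) for some $\bar c<\infty$, $\bar\beta<1$: $\sup_{i\in\mathbb{N},t\in[0,T],x^i,u^i,y}|c_t^i(x^i,u^i,y)|<\bar c$ (for $t=T$ read $c_T^i(x^i)$) and $\sup_{i\in\mathbb{N}}\beta^i<\bar\beta$. (A2) For all $t\in[0,T)$ and $\epsilon>0$ there is $\delta_\epsilon>0$ such that, in all games $\mathbb{G}^N$, $N\in\mathbb{N}$: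 $\sup_{i\in[1,N]}m_{\mathbb{X}^i\times\mathbb{U}^i}((x^i,u^i),(\tilde x^i,\tilde u^i))<\delta_\epsilon$ implies $m_{\mathbb{D}}(d_t^N(x,u),d_t^N(\tilde x,\tilde u))<\epsilon$; and, for all $t\in[0,T)$, $\lim_{N\to\infty}\sup_{i\in[1,N]}\sup m_{\mathbb{D}}(d_t^N(x,u),d_t^N(\tilde x,\tilde u))=0$, the inner supremum being over all $(x,u),(\tilde x,\tilde u)$ with $(x^j,u^j)=(\tilde x^j,\tilde u^j)$ for all $j\ne i$. (A3) The random variables $\omega^0:=(x_0^0,(w_t^0)_{t\in[0,T)},(\xi_t)_{t\in[0,T)})$ and $\omega^i:=(x_0^i,(w_t^i)_{t\in[0,T)})$, $i\in\mathbb{N}$, are mutually independent. *)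

theory Defs
  imports "HOL-Probability.Probability"
begin

subsection \<open>Compact metric spaces as types\<close>

class compact_metric_space = metric_space +
  assumes compact_UNIV: "compact (UNIV :: 'a set)"

instance compact_metric_space \<subseteq> second_countable_topology
proof
  have "\<exists>D. finite D \<and> (UNIV :: 'a set) \<subseteq> (\<Union>x\<in>D. ball x (1 / real (Suc n)))" for n
    using compactE_image[OF compact_UNIV, of UNIV "\<lambda>x::'a. ball x (1 / real (Suc n))"]
    by (metis UNIV_I UN_I centre_in_ball divide_pos_pos of_nat_0_less_iff open_ball subsetI
        zero_less_Suc zero_less_one)
  then obtain D :: "nat \<Rightarrow> 'a set" where D: "\<And>n. finite (D n)"
    "\<And>n. UNIV \<subseteq> (\<Union>x\<in>D n. ball x (1 / real (Suc n)))"
    by metis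
  define B where "B = (\<Union>n. (\<lambda>x. ball x (1 / real (Suc n))) ` D n)"
  have "countable B"
    unfolding B_def using D(1) by (auto intro: countable_finite)
  moreover have "topological_basis B"
  proof (rule topological_basisI)
    fix b assume "b \<in> B"
    then show "open b"
      by (auto simp: B_def)
  next
    fix V :: "'a set" and x assume "open V" "x \<in> V"
    then obtain e where e: "e > 0" "ball x e \<subseteq> V"
      using open_contains_ball by blast
    obtain n where n: "1 / real (Suc n) < e / 2"
      using nat_approx_posE[of "e / 2"] e(1) by auto
    obtain a where a: "a \<in> D n" "x \<in> ball a (1 / real (Suc n))"
      using D(2)[of n] by blast
    have "ball a (1 / real (Suc n)) \<subseteq> ball x e"
    proof
      fix z assume "z \<in> ball a (1 / real (Suc n))"
      then show "z \<in> ball x e"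
        using a(2) n dist_triangle2[of x z a] by (simp add: dist_commute)
    qed
    then show "\<exists>b\<in>B. x \<in> b \<and> b \<subseteq> V"
      using a e(2) by (auto simp: B_def)
  qed
  ultimately show "\<exists>B::'a set set. countable B \<and> open = generate_topology B"
    using topological_basis_imp_subbasis by blast
qed

instance compact_metric_space \<subseteq> complete_space
  by standard (use compact_imp_complete[OF compact_UNIV] in \<open>auto simp: complete_def convergent_def\<close>)

instance compact_metric_space \<subseteq> polish_space ..

definition prob_measures_on :: "'a::topological_space set \<Rightarrow> 'a measure set" where
  "prob_measures_on A = {\<mu>. prob_space \<mu> \<and> sets \<mu> = sets (restrict_space borel A)}"

definition uniformly_equicontinuous ::
  "'i set \<Rightarrow> ('i \<Rightarrow> 'a::metric_space \<Rightarrow> 'b::metric_space) \<Rightarrow> bool" where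
  "uniformly_equicontinuous I F \<longleftrightarrow>
     (\<forall>\<epsilon>>0. \<exists>\<delta>>0. \<forall>i\<in>I. \<forall>z z'. dist z z' < \<delta> \<longrightarrow> dist (F i z) (F i z') < \<epsilon>)"

subsection \<open>Policies\<close>

text \<open>
  The function space \<open>C(\<I>\<^sub>t \<times> \<Y>\<^bsup>[0,t)\<^esup>, \<U>)\<close> is represented by the bounded continuous functions of
  complete sequences \<open>(x, u, y)\<close> that depend only on \<open>x\<^sub>0, \<dots>, x\<^sub>t\<close>, \<open>u\<^sub>0, \<dots>, u\<^bsub>t-1\<^esub>\<close> and
  \<open>y\<^sub>0, \<dots>, y\<^bsub>t-1\<^esub>\<close>; composition with the projection is an isometry for the supremum metrics
  (the one on the type \<open>bcontfun\<close> being \<open>dist\<close>).  On compact spaces boundedness is automatic.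
\<close>

type_synonym ('x, 'u, 'y) policy = "((nat \<Rightarrow> 'x) \<times> (nat \<Rightarrow> 'u) \<times> (nat \<Rightarrow> 'y)) \<Rightarrow>\<^sub>C 'u"

type_synonym ('x, 'u, 'y) strategy = "nat \<Rightarrow> ('x, 'u, 'y) policy"

definition policies_at ::
  "nat \<Rightarrow> ('x::compact_metric_space, 'u::compact_metric_space, 'y::compact_metric_space) policy set"
  where
  "policies_at t = {\<phi>. \<forall>x x' u u' y y'.
     (\<forall>k\<le>t. x k = x' k) \<and> (\<forall>k<t. u k = u' k) \<and> (\<forall>k<t. y k = y' k)
       \<longrightarrow> apply_bcontfun \<phi> (x, u, y) = apply_bcontfun \<phi> (x', u', y')}"

subsection \<open>Sequences of games\<close>

text \<open>
  Decision makers are the numbers \<open>i \<ge> 1\<close>; the \<open>N\<close>th game is played by \<open>i \<in> {1..N}\<close>.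
  Fields taking a decision maker and a time take them in this order.  The maps \<open>aggr G N t\<close>
  are only used on \<open>\<X>\<^bsup>{1..N}\<^esup> \<times> \<U>\<^bsup>{1..N}\<^esup>\<close>, i.e. on functions that are extensional on \<open>{1..N}\<close>.
  Since the laws of the primitive random variables do not depend on \<open>N\<close>, all games are
  realised on one probability space.
\<close>

record (overloaded) ('x, 'u, 'w, 'y, 'v, 'r, 'q, 'd, 'o) game_seq =
  horizon :: enat
  dyn :: "nat \<Rightarrow> nat \<Rightarrow> 'x \<times> 'u \<times> 'y \<times> 'w \<Rightarrow> 'x"  \<comment> \<open>\<open>f\<^sub>t\<^sup>i\<close>\<close>
  stage_cost :: "nat \<Rightarrow> nat \<Rightarrow> 'x \<times> 'u \<times> 'y \<Rightarrow> real"  \<comment> \<open>\<open>c\<^sub>t\<^sup>i\<close>\<close>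
  terminal_cost :: "nat \<Rightarrow> 'x \<Rightarrow> real"  \<comment> \<open>\<open>c\<^sub>T\<^sup>i\<close>\<close>
  discount :: "nat \<Rightarrow> real"  \<comment> \<open>\<open>\<beta>\<^sup>i\<close>\<close>
  policies :: "nat \<Rightarrow> nat \<Rightarrow> ('x::compact_metric_space, 'u::compact_metric_space, 'y::compact_metric_space) policy set"
    \<comment> \<open>\<open>\<S>\<^sub>t\<^sup>i\<close>\<close>
  env_map :: "nat \<Rightarrow> 'v \<times> 'd \<times> 'q \<Rightarrow> 'y"  \<comment> \<open>\<open>g\<^sub>t\<close>\<close>
  env_dyn :: "nat \<Rightarrow> 'v \<times> 'd \<times> 'r \<Rightarrow> 'v"  \<comment> \<open>\<open>f\<^sub>t\<^sup>0\<close>\<close>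
  aggr :: "nat \<Rightarrow> nat \<Rightarrow> (nat \<Rightarrow> 'x) \<Rightarrow> (nat \<Rightarrow> 'u) \<Rightarrow> 'd"  \<comment> \<open>\<open>d\<^sub>t\<^sup>N\<close>, arguments \<open>N\<close> and \<open>t\<close>\<close>
  sample :: "'o measure"
  x_init :: "nat \<Rightarrow> 'o \<Rightarrow> 'x"  \<comment> \<open>\<open>x\<^sub>0\<^sup>i\<close>\<close>
  x_noise :: "nat \<Rightarrow> nat \<Rightarrow> 'o \<Rightarrow> 'w"  \<comment> \<open>\<open>w\<^sub>t\<^sup>i\<close>\<close>
  env_init :: "'o \<Rightarrow> 'v"  \<comment> \<open>\<open>x\<^sub>0\<^sup>0\<close>\<close>
  env_noise :: "nat \<Rightarrow> 'o \<Rightarrow> 'r"  \<comment> \<open>\<open>w\<^sub>t\<^sup>0\<close>\<close>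
  obs_noise :: "nat \<Rightarrow> 'o \<Rightarrow> 'q"  \<comment> \<open>\<open>\<xi>\<^sub>t\<close>\<close>

definition time_set :: "('x::compact_metric_space, 'u::compact_metric_space, 'w, 'y::compact_metric_space,
    'v, 'r, 'q, 'd, 'o) game_seq \<Rightarrow> nat set" where
  "time_set G = {t. enat t < horizon G}"

definition pure_strategies :: "('x::compact_metric_space, 'u::compact_metric_space, 'w,
    'y::compact_metric_space, 'v, 'r, 'q, 'd, 'o) game_seq \<Rightarrow> nat \<Rightarrow> ('x, 'u, 'y) strategy set" where
  "pure_strategies G i = (\<Pi>\<^sub>E t\<in>time_set G. policies G i t)"

definition mixed_strategies :: "('x::compact_metric_space, 'u::compact_metric_space, 'w,
    'y::compact_metric_space, 'v, 'r, 'q, 'd, 'o) game_seq \<Rightarrow> nat \<Rightarrow> ('x, 'u, 'y) strategy measure set"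
  where
  "mixed_strategies G i = prob_measures_on (pure_strategies G i)"

subsection \<open>Trajectories\<close>

text \<open>
  Trajectories of the \<open>N\<close>th game at the sample point \<open>\<omega>\<close> under the joint pure strategy \<open>s\<close>.
  The entries \<open>undefined\<close> in the histories are immaterial for policies in \<open>policies_at t\<close>.
\<close>

function
  x_path :: "('x::compact_metric_space, 'u::compact_metric_space, 'w, 'y::compact_metric_space,
    'v, 'r, 'q, 'd, 'o) game_seq \<Rightarrow> nat \<Rightarrow> (nat \<Rightarrow> ('x, 'u, 'y) strategy) \<Rightarrow> 'o \<Rightarrow> nat \<Rightarrow> nat \<Rightarrow> 'x" and
  u_path :: "('x, 'u, 'w, 'y, 'v, 'r, 'q, 'd, 'o) game_seq \<Rightarrow> nat \<Rightarrow> (nat \<Rightarrow> ('x, 'u, 'y) strategy) \<Rightarrow>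
    'o \<Rightarrow> nat \<Rightarrow> nat \<Rightarrow> 'u" and
  y_path :: "('x, 'u, 'w, 'y, 'v, 'r, 'q, 'd, 'o) game_seq \<Rightarrow> nat \<Rightarrow> (nat \<Rightarrow> ('x, 'u, 'y) strategy) \<Rightarrow>
    'o \<Rightarrow> nat \<Rightarrow> 'y" and
  env_path :: "('x, 'u, 'w, 'y, 'v, 'r, 'q, 'd, 'o) game_seq \<Rightarrow> nat \<Rightarrow> (nat \<Rightarrow> ('x, 'u, 'y) strategy) \<Rightarrow>
    'o \<Rightarrow> nat \<Rightarrow> 'v"
where
  "x_path G N s \<omega> i 0 = x_init G i \<omega>"
| "x_path G N s \<omega> i (Suc t) =
     dyn G i t (x_path G N s \<omega> i t, u_path G N s \<omega> i t, y_path G N s \<omega> t, x_noise G i t \<omega>)"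
| "u_path G N s \<omega> i t =
     apply_bcontfun (s i t)
       (\<lambda>k. if k \<le> t then x_path G N s \<omega> i k else undefined,
        \<lambda>k. if k < t then u_path G N s \<omega> i k else undefined,
        \<lambda>k. if k < t then y_path G N s \<omega> k else undefined)"
| "y_path G N s \<omega> t =
     env_map G t (env_path G N s \<omega> t,
       aggr G N t (\<lambda>j\<in>{1..N}. x_path G N s \<omega> j t) (\<lambda>j\<in>{1..N}. u_path G N s \<omega> j t),
       obs_noise G t \<omega>)"
| "env_path G N s \<omega> 0 = env_init G \<omega>"
| "env_path G N s \<omega> (Suc t) =
     env_dyn G t (env_path G N s \<omega> t,
       aggr G N t (\<lambda>j\<in>{1..N}. x_path G N s \<omega> j t) (\<lambda>j\<in>{1..N}. u_path G N s \<omega> j t),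
       env_noise G t \<omega>)"
  by pat_completeness auto
termination
  by (relation "Wellfounded.measure (\<lambda>a. case a of
        Inl (Inl (G, N, s, \<omega>, i, t)) \<Rightarrow> 3 * t
      | Inl (Inr (G, N, s, \<omega>, i, t)) \<Rightarrow> 3 * t + 1
      | Inr (Inl (G, N, s, \<omega>, t)) \<Rightarrow> 3 * t + 2
      | Inr (Inr (G, N, s, \<omega>, t)) \<Rightarrow> 3 * t)") auto

declare x_path.simps [simp del] u_path.simps [simp del] y_path.simps [simp del]
  env_path.simps [simp del]

text \<open>Trajectories of a single decision maker facing a deterministic environment sequence \<open>z\<close>.\<close>

function
  x_dec :: "('x::compact_metric_space, 'u::compact_metric_space, 'w, 'y::compact_metric_space,
    'v, 'r, 'q, 'd, 'o) game_seq \<Rightarrow> nat \<Rightarrow> ('x, 'u, 'y) strategy \<Rightarrow> (nat \<Rightarrow> 'y) \<Rightarrow> 'o \<Rightarrow> nat \<Rightarrow> 'x" and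
  u_dec :: "('x, 'u, 'w, 'y, 'v, 'r, 'q, 'd, 'o) game_seq \<Rightarrow> nat \<Rightarrow> ('x, 'u, 'y) strategy \<Rightarrow>
    (nat \<Rightarrow> 'y) \<Rightarrow> 'o \<Rightarrow> nat \<Rightarrow> 'u"
where
  "x_dec G i s z \<omega> 0 = x_init G i \<omega>"
| "x_dec G i s z \<omega> (Suc t) =
     dyn G i t (x_dec G i s z \<omega> t, u_dec G i s z \<omega> t, z t, x_noise G i t \<omega>)"
| "u_dec G i s z \<omega> t =
     apply_bcontfun (s t)
       (\<lambda>k. if k \<le> t then x_dec G i s z \<omega> k else undefined,
        \<lambda>k. if k < t then u_dec G i s z \<omega> k else undefined,
        \<lambda>k. if k < t then z k else undefined)"
  by pat_completeness auto
termination
  by (relation "Wellfounded.measure (\<lambda>a. case a of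
        Inl (G, i, s, z, \<omega>, t) \<Rightarrow> 2 * t
      | Inr (G, i, s, z, \<omega>, t) \<Rightarrow> 2 * t + 1)") auto

declare x_dec.simps [simp del] u_dec.simps [simp del]

subsection \<open>Costs and SEBEU\<close>

definition discounted_cost :: "('x::compact_metric_space, 'u::compact_metric_space, 'w,
    'y::compact_metric_space, 'v, 'r, 'q, 'd, 'o) game_seq \<Rightarrow> nat \<Rightarrow>
    (nat \<Rightarrow> 'x) \<Rightarrow> (nat \<Rightarrow> 'u) \<Rightarrow> (nat \<Rightarrow> 'y) \<Rightarrow> real" where
  "discounted_cost G i x u y =
     (\<Sum>t. if t \<in> time_set G then discount G i ^ t * stage_cost G i t (x t, u t, y t) else 0)
     + (case horizon G of enat n \<Rightarrow> discount G i ^ n * terminal_cost G i (x n) | \<infinity> \<Rightarrow> 0)"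

definition J_dec :: "('x::compact_metric_space, 'u::compact_metric_space, 'w,
    'y::compact_metric_space, 'v, 'r, 'q, 'd, 'o) game_seq \<Rightarrow> nat \<Rightarrow>
    ('x, 'u, 'y) strategy \<Rightarrow> (nat \<Rightarrow> 'y) \<Rightarrow> real" where
  "J_dec G i s z =
     (\<integral>\<omega>. discounted_cost G i (x_dec G i s z \<omega>) (u_dec G i s z \<omega>) z \<partial>sample G)"

definition expected_J_dec :: "('x::compact_metric_space, 'u::compact_metric_space, 'w,
    'y::compact_metric_space, 'v, 'r, 'q, 'd, 'o) game_seq \<Rightarrow> nat \<Rightarrow>
    ('x, 'u, 'y) strategy measure \<Rightarrow> (nat \<Rightarrow> 'y) measure \<Rightarrow> real" where
  "expected_J_dec G i \<mu> \<zeta> = (\<integral>z. (\<integral>s. J_dec G i s z \<partial>\<mu>) \<partial>\<zeta>)"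

definition J_game :: "('x::compact_metric_space, 'u::compact_metric_space, 'w,
    'y::compact_metric_space, 'v, 'r, 'q, 'd, 'o) game_seq \<Rightarrow> nat \<Rightarrow> nat \<Rightarrow>
    (nat \<Rightarrow> ('x, 'u, 'y) strategy) \<Rightarrow> real" where
  "J_game G N i s =
     (\<integral>\<omega>. discounted_cost G i (x_path G N s \<omega> i) (u_path G N s \<omega> i) (y_path G N s \<omega>) \<partial>sample G)"

definition expected_J_game :: "('x::compact_metric_space, 'u::compact_metric_space, 'w,
    'y::compact_metric_space, 'v, 'r, 'q, 'd, 'o) game_seq \<Rightarrow> nat \<Rightarrow> nat \<Rightarrow>
    (nat \<Rightarrow> ('x, 'u, 'y) strategy measure) \<Rightarrow> real" where
  "expected_J_game G N i \<gamma> = (\<integral>s. J_game G N i s \<partial>(\<Pi>\<^sub>M j\<in>{1..N}. \<gamma> j))"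

definition env_law :: "('x::compact_metric_space, 'u::compact_metric_space, 'w,
    'y::compact_metric_space, 'v, 'r, 'q, 'd, 'o) game_seq \<Rightarrow> nat \<Rightarrow>
    (nat \<Rightarrow> ('x, 'u, 'y) strategy measure) \<Rightarrow> (nat \<Rightarrow> 'y) measure" where
  "env_law G N \<gamma> =
     distr ((\<Pi>\<^sub>M j\<in>{1..N}. \<gamma> j) \<Otimes>\<^sub>M sample G)
       (restrict_space borel (time_set G \<rightarrow>\<^sub>E UNIV))
       (\<lambda>(s, \<omega>). \<lambda>t\<in>time_set G. y_path G N s \<omega> t)"

definition is_SEBEU :: "('x::compact_metric_space, 'u::compact_metric_space, 'w,
    'y::compact_metric_space, 'v, 'r, 'q, 'd, 'o) game_seq \<Rightarrow> nat \<Rightarrow>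
    (nat \<Rightarrow> ('x, 'u, 'y) strategy measure) \<Rightarrow> bool" where
  "is_SEBEU G N \<gamma> \<longleftrightarrow>
     (\<forall>i\<in>{1..N}. \<gamma> i \<in> mixed_strategies G i) \<and>
     (\<forall>i\<in>{1..N}. \<forall>\<gamma>'\<in>mixed_strategies G i.
        expected_J_dec G i (\<gamma> i) (env_law G N \<gamma>) \<le> expected_J_dec G i \<gamma>' (env_law G N \<gamma>))"

definition is_eps_Nash :: "real \<Rightarrow> ('x::compact_metric_space, 'u::compact_metric_space, 'w,
    'y::compact_metric_space, 'v, 'r, 'q, 'd, 'o) game_seq \<Rightarrow> nat \<Rightarrow>
    (nat \<Rightarrow> ('x, 'u, 'y) strategy measure) \<Rightarrow> bool" where
  "is_eps_Nash \<epsilon> G N \<gamma> \<longleftrightarrow>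
     (\<forall>i\<in>{1..N}. \<gamma> i \<in> mixed_strategies G i) \<and>
     (\<forall>i\<in>{1..N}. \<forall>\<gamma>'\<in>mixed_strategies G i.
        expected_J_game G N i \<gamma> \<le> expected_J_game G N i (\<gamma>(i := \<gamma>')) + \<epsilon>)"

subsection \<open>Standing assumptions\<close>

definition game_setting :: "('x::compact_metric_space, 'u::compact_metric_space,
    'w::compact_metric_space, 'y::compact_metric_space, 'v::compact_metric_space,
    'r::compact_metric_space, 'q::compact_metric_space, 'd::compact_metric_space, 'o) game_seq \<Rightarrow> bool"
  where
  "game_setting G \<longleftrightarrow>
     0 < horizon G \<and>
     (\<forall>i\<ge>1. 0 < discount G i \<and> discount G i \<le> 1) \<and>
     (horizon G = \<infinity> \<longrightarrow> (\<forall>i\<ge>1. discount G i < 1 \<and> terminal_cost G i = (\<lambda>x. 0))) \<and>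
     prob_space (sample G) \<and>
     (\<forall>i\<ge>1. x_init G i \<in> sample G \<rightarrow>\<^sub>M borel) \<and>
     (\<forall>i\<ge>1. \<forall>t\<in>time_set G. x_noise G i t \<in> sample G \<rightarrow>\<^sub>M borel) \<and>
     env_init G \<in> sample G \<rightarrow>\<^sub>M borel \<and>
     (\<forall>t\<in>time_set G. env_noise G t \<in> sample G \<rightarrow>\<^sub>M borel) \<and>
     (\<forall>t\<in>time_set G. obs_noise G t \<in> sample G \<rightarrow>\<^sub>M borel)"

text \<open>
  Compactness of the spaces, and their independence of the decision maker, are part of the typing.
\<close>

definition condition_A1 :: "('x::compact_metric_space, 'u::compact_metric_space,
    'w::compact_metric_space, 'y::compact_metric_space, 'v::compact_metric_space,
    'r::compact_metric_space, 'q::compact_metric_space, 'd::compact_metric_space, 'o) game_seq \<Rightarrow> bool"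
  where
  "condition_A1 G \<longleftrightarrow>
     (\<forall>t\<in>time_set G. \<forall>i\<ge>1. continuous_on UNIV (dyn G i t) \<and> continuous_on UNIV (stage_cost G i t)) \<and>
     (\<forall>i\<ge>1. continuous_on UNIV (terminal_cost G i)) \<and>
     (\<forall>t\<in>time_set G. continuous_on UNIV (env_dyn G t) \<and> continuous_on UNIV (env_map G t)) \<and>
     (\<forall>i\<ge>1. \<forall>t\<in>time_set G. policies G i t \<subseteq> policies_at t \<and> policies G i t \<noteq> {} \<and>
        compact (policies G i t)) \<and>
     (\<forall>i\<ge>1. pure_strategies G i = pure_strategies G 1) \<and>
     (\<forall>t\<in>time_set G. uniformly_equicontinuous {1..} (\<lambda>i. stage_cost G i t) \<and>
        uniformly_equicontinuous {1..} (\<lambda>i. dyn G i t)) \<and>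
     uniformly_equicontinuous {1..} (terminal_cost G) \<and>
     (\<exists>C. (\<forall>i\<ge>1. \<forall>t\<in>time_set G. \<forall>x u y. \<bar>stage_cost G i t (x, u, y)\<bar> < C) \<and>
          (\<forall>i\<ge>1. \<forall>x. \<bar>terminal_cost G i x\<bar> < C)) \<and>
     (\<exists>b<1. (SUP i\<in>{1..}. discount G i) < b)"

definition condition_A2 :: "('x::compact_metric_space, 'u::compact_metric_space,
    'w::compact_metric_space, 'y::compact_metric_space, 'v::compact_metric_space,
    'r::compact_metric_space, 'q::compact_metric_space, 'd::compact_metric_space, 'o) game_seq \<Rightarrow> bool"
  where
  "condition_A2 G \<longleftrightarrow>
     (\<forall>t\<in>time_set G. \<forall>\<epsilon>>0. \<exists>\<delta>>0. \<forall>N\<ge>1.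
        \<forall>x\<in>{1..N} \<rightarrow>\<^sub>E UNIV. \<forall>u\<in>{1..N} \<rightarrow>\<^sub>E UNIV. \<forall>x'\<in>{1..N} \<rightarrow>\<^sub>E UNIV. \<forall>u'\<in>{1..N} \<rightarrow>\<^sub>E UNIV.
          (SUP i\<in>{1..N}. dist (x i, u i) (x' i, u' i)) < \<delta>
            \<longrightarrow> dist (aggr G N t x u) (aggr G N t x' u') < \<epsilon>) \<and>
     (\<forall>t\<in>time_set G.
        (\<lambda>N. SUP i\<in>{1..N}. Sup {dist (aggr G N t x u) (aggr G N t x' u') | x u x' u'.
            x \<in> {1..N} \<rightarrow>\<^sub>E UNIV \<and> u \<in> {1..N} \<rightarrow>\<^sub>E UNIV \<and>
            x' \<in> {1..N} \<rightarrow>\<^sub>E UNIV \<and> u' \<in> {1..N} \<rightarrow>\<^sub>E UNIV \<and>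
            (\<forall>j\<in>{1..N} - {i}. (x j, u j) = (x' j, u' j))}) \<longlonglongrightarrow> 0)"

definition omega0 :: "('x::compact_metric_space, 'u::compact_metric_space, 'w,
    'y::compact_metric_space, 'v, 'r, 'q, 'd, 'o) game_seq \<Rightarrow>
    'o \<Rightarrow> 'v \<times> (nat \<Rightarrow> 'r) \<times> (nat \<Rightarrow> 'q)" where
  "omega0 G = (\<lambda>\<omega>. (env_init G \<omega>, \<lambda>t\<in>time_set G. env_noise G t \<omega>, \<lambda>t\<in>time_set G. obs_noise G t \<omega>))"

definition omega :: "('x::compact_metric_space, 'u::compact_metric_space, 'w,
    'y::compact_metric_space, 'v, 'r, 'q, 'd, 'o) game_seq \<Rightarrow> nat \<Rightarrow> 'o \<Rightarrow> 'x \<times> (nat \<Rightarrow> 'w)" where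
  "omega G i = (\<lambda>\<omega>. (x_init G i \<omega>, \<lambda>t\<in>time_set G. x_noise G i t \<omega>))"

text \<open>
  The random variables have different types, so \<open>indep_vars\<close> does not apply; as in its
  definition, independence is that of the generated \<open>\<sigma>\<close>-algebras.
\<close>

definition condition_A3 :: "('x::compact_metric_space, 'u::compact_metric_space,
    'w::compact_metric_space, 'y::compact_metric_space, 'v::compact_metric_space,
    'r::compact_metric_space, 'q::compact_metric_space, 'd::compact_metric_space, 'o) game_seq \<Rightarrow> bool"
  where
  "condition_A3 G \<longleftrightarrow>
     prob_space.indep_sets (sample G)
       (\<lambda>i. if i = 0 then {omega0 G -` A \<inter> space (sample G) | A. A \<in> sets borel}
            else {omega G i -` A \<inter> space (sample G) | A. A \<in> sets borel})
       (UNIV :: nat set)"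

end

theory Submission
  imports Defs
begin

text \<open>
  Compare each game with the one in which decision maker \<open>i\<close> is frozen: strategy, initial state and
  noise of \<open>i\<close> are replaced by constants.  By (A2) the influence of one decision maker on the
  aggregate vanishes, and by equicontinuity (uniform in the decision maker and the
  strategies, because all \<open>\<S>\<^sup>i\<close> coincide and are compact) the environment sequence moves by
  arbitrarily little on any finite time window, uniformly in everything, when \<open>N\<close> is large;
  discounting takes care of the remaining times.  The frozen environment is independent of
  \<open>s\<^sup>i\<close> and \<open>\<omega>\<^sup>i\<close>, so the expected cost of \<open>i\<close> against it is the same whether \<open>i\<close> plays inside
  the game or responds to an independent copy of the sequence.  Hence the game cost after a
  deviation to \<open>\<mu>\<close> and the cost of \<open>\<mu>\<close> against the law of the equilibrium environment differ by at
  most \<open>\<epsilon>/2\<close>, and SEBEU optimality with respect to the latter costs at most \<open>\<epsilon>\<close> in the former.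
\<close>

subsection \<open>Metric and measure-theoretic preliminaries\<close>

text \<open>The obstacle is correlation. In the game one sample point drives both the path of
  \<open>i\<close> and, through the aggregate, the environment, whereas
  \<open>expected_J_dec\<close> averages over a sequence drawn independently of the response. With
  only the strategy frozen, the environment would still feel the noise of \<open>i\<close> through
  its state; hence initial state and noise are frozen too. All comparisons are pathwise, at each
  sample point and for each pure profile, so no convergence of laws is involved. Moduli of
  continuity carry no Lipschitz rate, so errors cannot be propagated forward with explicit
  constants; each tolerance is chosen backwards in time from the one wanted at the end. The time
  window is fixed by the cost alone, before \<open>N\<close>, so that only finitely many "for all
  large \<open>N\<close>" statements are combined. This is what allows a deviation to be judged
  against the environment law of the undeviated profile.\<close>

lemma dist_Pair_le: "dist (a, b) (c, d) \<le> dist a c + dist b d"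
  unfolding dist_Pair_Pair by (rule sqrt_sum_squares_le_sum) auto

text \<open>The product metric weights the coordinates by the powers of 1/2, whose sum is the factor
  2.\<close>

lemma dist_fun_le:
  fixes f g :: "nat \<Rightarrow> 'a::metric_space"
  assumes "\<And>k. dist (f k) (g k) \<le> e"
  shows "dist f g \<le> 2 * e"
proof -
  have sm: "summable (\<lambda>n. (1/2::real)^n * e)"
    by (intro summable_mult2 summable_geometric) auto
  have le: "(1/2)^n * min (dist (f (from_nat n)) (g (from_nat n))) 1 \<le> (1/2::real)^n * e" for n
    using assms[of "from_nat n"] by (intro mult_left_mono) auto
  have "dist f g \<le> (\<Sum>n. (1/2::real)^n * e)"
    unfolding dist_fun_def
  proof (rule suminf_le[OF le _ sm])
    show "summable (\<lambda>n. (1/2)^n * min (dist (f (from_nat n)) (g (from_nat n))) (1::real))"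
      by (rule summable_comparison_test'[OF sm, of 0]) (use le in \<open>simp\<close>)
  qed
  also have "\<dots> = 2 * e"
    using suminf_mult2[of "\<lambda>n. (1/2::real)^n" e] suminf_geometric[of "1/2::real"] by simp
  finally show ?thesis .
qed

text \<open>Tychonoff. Policies are functions of complete sequences, so their common domain is
  compact.\<close>

lemma compact_UNIV_fun: "compact (UNIV :: ('i \<Rightarrow> 'a::compact_metric_space) set)"
proof -
  have "compact_space (product_topology (\<lambda>_::'i. euclidean :: 'a topology) UNIV)"
    unfolding compact_space_product_topology by (simp add: compact_space_def compact_UNIV)
  then show ?thesis
    by (simp add: compact_space_def euclidean_product_topology)
qed

lemma compact_UNIV_prod:
  "compact (UNIV :: 'a::topological_space set) \<Longrightarrow> compact (UNIV :: 'b::topological_space set) \<Longrightarrow>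
    compact (UNIV :: ('a \<times> 'b) set)"
  using compact_Times[of UNIV UNIV] by simp

lemma compact_space_uniform:
  fixes f :: "'a::metric_space \<Rightarrow> 'b::metric_space"
  assumes "compact (UNIV :: 'a set)" "continuous_on UNIV f" "e > 0"
  obtains d where "d > 0" "\<And>x y. dist x y < d \<Longrightarrow> dist (f x) (f y) < e"
  using compact_uniformly_continuous[OF assms(2,1)] assms(3)
  unfolding uniformly_continuous_on_def by (metis UNIV_I)

text \<open>The easy direction of Arzela-Ascoli: a finite net of radius e/3 in the supremum metric
  reduces the claim to finitely many uniformly continuous functions, and the rest is a three-step
  triangle inequality.\<close>

lemma compact_bcontfun_equicontinuous:
  fixes S :: "('a::metric_space \<Rightarrow>\<^sub>C 'b::metric_space) set"
  assumes "compact (UNIV :: 'a set)" "compact S"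
  shows "uniformly_equicontinuous S apply_bcontfun"
  unfolding uniformly_equicontinuous_def
proof (intro allI impI)
  fix e :: real assume e: "e > 0"
  obtain F where F: "finite F" "F \<subseteq> S" "S \<subseteq> (\<Union>f\<in>F. ball f (e/3))"
  proof (rule compactE_image[OF assms(2), of S "\<lambda>f. ball f (e/3)"])
    show "S \<subseteq> (\<Union>f\<in>S. ball f (e/3))" using e by (auto intro!: bexI)
  qed auto
  have "\<exists>d>0. \<forall>x y. dist x y < d \<longrightarrow> dist (apply_bcontfun f x) (apply_bcontfun f y) < e/3" for f ::
    "'a \<Rightarrow>\<^sub>C 'b"
    using compact_space_uniform[OF assms(1), of "apply_bcontfun f" "e/3"] e
    by (metis continuous_on_apply_bcontfun divide_pos_pos zero_less_numeral)
  then obtain d where d: "\<And>f::'a \<Rightarrow>\<^sub>C 'b. d f > 0"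
    "\<And>f x y. dist x y < d f \<Longrightarrow> dist (apply_bcontfun f x) (apply_bcontfun f y) < e/3"
    by metis
  define D where "D = Min (insert 1 (d ` F))"
  have "D > 0" using F(1) d(1) by (auto simp: D_def)
  moreover have "dist (apply_bcontfun g x) (apply_bcontfun g y) < e"
    if "g \<in> S" "dist x y < D" for g x y
  proof -
    obtain f where f: "f \<in> F" "dist f g < e/3" using F(3) \<open>g \<in> S\<close> by auto
    have "dist x y < d f" using that(2) F(1) f(1) by (auto simp: D_def)
    then have "dist (apply_bcontfun f x) (apply_bcontfun f y) < e/3" by (rule d(2))
    moreover have "dist (apply_bcontfun f x) (apply_bcontfun g x) < e/3" for x
      using dist_bounded[of f x g] f(2) by linarith
    ultimately show ?thesis
      using dist_triangle_third[of "apply_bcontfun g x" "apply_bcontfun f x" e "apply_bcontfun f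
        y" "apply_bcontfun g y"]
      by (simp add: dist_commute)
  qed
  ultimately show "\<exists>\<delta>>0. \<forall>i\<in>S. \<forall>z z'. dist z z' < \<delta> \<longrightarrow> dist (apply_bcontfun i z) (apply_bcontfun i
    z') < e"
    by blast
qed

text \<open>Bounded continuous functions need not form a separable space, so joint continuity of
  evaluation does not yield measurability for the product sigma-algebra. Instead \<open>h\<close> is
  approximated by simple functions: evaluation at finitely many fixed points is measurable in
  \<open>\<phi>\<close>, and continuity of each \<open>\<phi> m\<close> passes to the limit.\<close>

lemma borel_measurable_apply_bcontfun:
  fixes h :: "'m \<Rightarrow> 'a::{metric_space, second_countable_topology}"
    and \<phi> :: "'m \<Rightarrow> 'a \<Rightarrow>\<^sub>C 'b::metric_space"
  assumes \<phi>: "\<phi> \<in> borel_measurable M" and h: "h \<in> borel_measurable M"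
  shows "(\<lambda>m. apply_bcontfun (\<phi> m) (h m)) \<in> borel_measurable M"
proof -
  obtain F where F: "\<And>i::nat. simple_function M (F i)" "\<And>m. m \<in> space M \<Longrightarrow> (\<lambda>i. F i m) \<longlonglongrightarrow> h m"
    using borel_measurable_implies_sequence_metric[OF h, of undefined] by blast
  have ev: "(\<lambda>m. apply_bcontfun (\<phi> m) a) \<in> borel_measurable M" for a
  proof (rule measurable_compose[OF \<phi>], rule borel_measurable_continuous_onI)
    show "continuous_on UNIV (\<lambda>f. apply_bcontfun f a :: 'b)"
    proof -
      have "\<forall>f'\<in>UNIV. dist f' f < e \<longrightarrow> dist (apply_bcontfun f' a) (apply_bcontfun f a :: 'b) < e"
        for f e
        using le_less_trans[OF dist_bounded[of _ a f]] by blast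
      then show ?thesis unfolding continuous_on_iff by blast
    qed
  qed
  show ?thesis
  proof (rule borel_measurable_LIMSEQ_metric)
    fix i
    show "(\<lambda>m. apply_bcontfun (\<phi> m) (F i m)) \<in> borel_measurable M"
    proof (rule measurable_compose_countable'[where f = "\<lambda>a m. apply_bcontfun (\<phi> m) a" and g =
      "F i"])
      show "F i \<in> M \<rightarrow>\<^sub>M count_space (F i ` space M)"
        using simple_functionD[OF F(1)[of i]]
        by (auto simp: measurable_count_space_eq2)
      show "countable (F i ` space M)"
        using F(1)[of i] by (auto simp: simple_function_def intro: countable_finite)
    qed (rule ev)
  next
    fix m assume "m \<in> space M"
    then show "(\<lambda>i. apply_bcontfun (\<phi> m) (F i m)) \<longlonglongrightarrow> apply_bcontfun (\<phi> m) (h m)"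
      by (intro continuous_on_tendsto_compose[OF continuous_on_apply_bcontfun[of UNIV "\<phi> m"]]
        F(2)) auto
  qed
qed

lemma (in prob_space) integral_close:
  fixes f g :: "'a \<Rightarrow> real"
  assumes [measurable]: "f \<in> borel_measurable M" "g \<in> borel_measurable M"
    and b: "\<And>x. x \<in> space M \<Longrightarrow> \<bar>f x\<bar> \<le> B" "\<And>x. x \<in> space M \<Longrightarrow> \<bar>g x\<bar> \<le> B"
    and c: "\<And>x. x \<in> space M \<Longrightarrow> \<bar>f x - g x\<bar> \<le> e"
  shows "\<bar>(\<integral>x. f x \<partial>M) - (\<integral>x. g x \<partial>M)\<bar> \<le> e"
proof -
  have i: "integrable M f" "integrable M g"
    using b by (auto intro!: integrable_const_bound[where B=B])
  have "\<bar>\<integral>x. (f x - g x) \<partial>M\<bar> \<le> (\<integral>x. \<bar>f x - g x\<bar> \<partial>M)"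
    by (rule integral_abs_bound)
  also have "\<dots> \<le> (\<integral>x. e \<partial>M)"
    using i c by (intro integral_mono) auto
  also have "\<dots> = e" by (simp add: prob_space)
  finally show ?thesis using i by simp
qed

lemma (in prob_space) integral_abs_le:
  fixes f :: "'a \<Rightarrow> real"
  assumes b: "\<And>x. x \<in> space M \<Longrightarrow> \<bar>f x\<bar> \<le> B"
  shows "\<bar>\<integral>x. f x \<partial>M\<bar> \<le> B"
proof (cases "integrable M f")
  case True
  have "\<bar>\<integral>x. f x \<partial>M\<bar> \<le> (\<integral>x. \<bar>f x\<bar> \<partial>M)" by (rule integral_abs_bound)
  also have "\<dots> \<le> (\<integral>x. B \<partial>M)" using True b by (intro integral_mono) auto
  finally show ?thesis by (simp add: prob_space)
next
  case False
  \<comment> \<open>A non-integrable function has integral 0 by convention, so only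
    \<open>0 \<le> B\<close> remains, and it follows from the bound at any point.\<close>
  obtain x where "x \<in> space M" using not_empty by blast
  with b have "0 \<le> B" by (meson abs_ge_zero order_trans)
  with False show ?thesis by (simp add: not_integrable_integral_eq)
qed

subsection \<open>Equicontinuity of the trajectories\<close>

text \<open>Decision maker \<open>i\<close> receives a constant initial state and constant noise, so that the
  environment no longer depends on \<open>\<omega>\<^sup>i\<close>.\<close>

definition freeze :: "('x::compact_metric_space, 'u::compact_metric_space, 'w,
  'y::compact_metric_space,
    'v, 'r, 'q, 'd, 'o) game_seq \<Rightarrow> nat \<Rightarrow> ('x, 'u, 'w, 'y, 'v, 'r, 'q, 'd, 'o) game_seq" where
  "freeze G i = G\<lparr>x_init := (x_init G)(i := \<lambda>_. undefined), x_noise := (x_noise G)(i :=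
    \<lambda>_ _. undefined)\<rparr>"

lemma freeze_sel [simp]:
  "horizon (freeze G i) = horizon G" "time_set (freeze G i) = time_set G"
  "dyn (freeze G i) = dyn G" "env_map (freeze G i) = env_map G" "env_dyn (freeze G i) = env_dyn G"
  "aggr (freeze G i) = aggr G" "env_init (freeze G i) = env_init G"
  "env_noise (freeze G i) = env_noise G" "obs_noise (freeze G i) = obs_noise G"
  "x_init (freeze G i) j = (if j = i then \<lambda>_. undefined else x_init G j)"
  "x_noise (freeze G i) j = (if j = i then \<lambda>_ _. undefined else x_noise G j)"
  by (auto simp: freeze_def time_set_def)

lemma dec_freeze:
  assumes "j \<noteq> i"
  shows "x_dec (freeze G i) j s z \<omega> t = x_dec G j s z \<omega> t \<and> u_dec (freeze G i) j s z \<omega> t =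
    u_dec G j s z \<omega> t"
proof (induction t rule: less_induct)
  case (less t)
  have x: "x_dec (freeze G i) j s z \<omega> t = x_dec G j s z \<omega> t"
  proof (cases t)
    case (Suc k)
    with less[of k] assms show ?thesis by (simp add: x_dec.simps)
  qed (use assms in \<open>simp add: x_dec.simps\<close>)
  then have "(if k \<le> t then x_dec (freeze G i) j s z \<omega> k else undefined) = (if k \<le>
    t then x_dec G j s z \<omega> k else undefined)" for k
    using less by (cases "k = t") auto
  moreover have "(if k < t then u_dec (freeze G i) j s z \<omega> k else undefined) =
    (if k < t then u_dec G j s z \<omega> k else undefined)" for k
    using less by auto
  ultimately show ?case using x by (simp add: u_dec.simps[of _ _ _ _ _ t])
qed

text \<open>The two recursions differ only in the source of the environment values, so feeding the
  realised sequence into the single-agent recursion reproduces the game path. Every later estimate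
  thereby becomes a question about how responses depend on the sequence.\<close>

lemma path_eq_dec:
  "x_path G N s \<omega> i t = x_dec G i (s i) (y_path G N s \<omega>) \<omega> t \<and>
   u_path G N s \<omega> i t = u_dec G i (s i) (y_path G N s \<omega>) \<omega> t"
proof (induction t rule: less_induct)
  case (less t)
  have x: "x_path G N s \<omega> i t = x_dec G i (s i) (y_path G N s \<omega>) \<omega> t"
  proof (cases t)
    case (Suc k)
    with less[of k] show ?thesis by (simp add: x_path.simps x_dec.simps)
  qed (simp add: x_path.simps x_dec.simps)
  \<comment> \<open>The control at \<open>t\<close> reads the state at \<open>t\<close> itself, so
    the equality just proved is needed in addition to the induction hypothesis.\<close>
  then have "(if k \<le> t then x_path G N s \<omega> i k else undefined) = (if k \<le>
    t then x_dec G i (s i) (y_path G N s \<omega>) \<omega> k else undefined)" for k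
    using less by (cases "k = t") auto
  moreover have "(if k < t then u_path G N s \<omega> i k else undefined) =
    (if k < t then u_dec G i (s i) (y_path G N s \<omega>) \<omega> k else undefined)" for k
    using less by auto
  ultimately show ?case using x by (simp add: u_path.simps[of _ _ _ _ _ t] u_dec.simps[of _ _ _ _
    _ t])
qed

lemmas x_path_eq_dec = path_eq_dec[THEN conjunct1] and u_path_eq_dec = path_eq_dec[THEN conjunct2]

text \<open>Responses are non-anticipative: the value \<open>z t\<close> first acts on the state at
  time \<open>Suc t\<close>.\<close>

lemma dec_cong:
  assumes "\<And>k. k < t \<Longrightarrow> z k = z' k"
  shows "x_dec G i s z \<omega> t = x_dec G i s z' \<omega> t \<and> u_dec G i s z \<omega> t = u_dec G i s z' \<omega> t"
  using assms
proof (induction t rule: less_induct)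
  case (less t)
  have x: "x_dec G i s z \<omega> t = x_dec G i s z' \<omega> t"
  proof (cases t)
    case (Suc k)
    with less.IH[of k] less.prems show ?thesis by (simp add: x_dec.simps)
  qed (simp add: x_dec.simps)
  then have "(if k \<le> t then x_dec G i s z \<omega> k else undefined) = (if k \<le>
    t then x_dec G i s z' \<omega> k else undefined)" for k
    using less by (cases "k = t") auto
  moreover have "(if k < t then u_dec G i s z \<omega> k else undefined) =
    (if k < t then u_dec G i s z' \<omega> k else undefined)" for k
    using less by auto
  moreover have "(if k < t then z k else undefined) = (if k < t then z' k else undefined)" for k
    using less.prems by auto
  ultimately show ?case using x by (simp add: u_dec.simps[of _ _ _ _ _ t])
qed

lemma in_time_set_mono: "t \<in> time_set G \<Longrightarrow> k \<le> t \<Longrightarrow> k \<in> time_set G"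
  unfolding time_set_def by (metis enat_ord_simps(1) le_less_trans mem_Collect_eq)

section \<open>Equicontinuity of responses in the environment sequence, uniform in decision maker,
  strategy and noise\<close>

locale game_sequence =
  fixes G :: "('x::compact_metric_space, 'u::compact_metric_space, 'w::compact_metric_space,
    'y::compact_metric_space, 'v::compact_metric_space, 'r::compact_metric_space,
    'q::compact_metric_space, 'd::compact_metric_space, 'o) game_seq"
  assumes setting: "game_setting G" and A1: "condition_A1 G" and A2: "condition_A2 G" and A3:
    "condition_A3 G"
begin

abbreviation "\<T> \<equiv> time_set G"

lemma A1_policies: "i \<ge> 1 \<Longrightarrow> t \<in> \<T> \<Longrightarrow> policies G i t \<noteq> {}"
  and A1_compact: "i \<ge> 1 \<Longrightarrow> t \<in> \<T> \<Longrightarrow> compact (policies G i t)"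
  and A1_pure: "i \<ge> 1 \<Longrightarrow> pure_strategies G i = pure_strategies G 1"
  and A1_dyn: "t \<in> \<T> \<Longrightarrow> uniformly_equicontinuous {1..} (\<lambda>i. dyn G i t)"
  and A1_cost: "t \<in> \<T> \<Longrightarrow> uniformly_equicontinuous {1..} (\<lambda>i. stage_cost G i t)"
  and A1_terminal: "uniformly_equicontinuous {1..} (terminal_cost G)"
  and A1_dyn_cont: "i \<ge> 1 \<Longrightarrow> t \<in> \<T> \<Longrightarrow> continuous_on UNIV (dyn G i t)"
  and A1_cost_cont: "i \<ge> 1 \<Longrightarrow> t \<in> \<T> \<Longrightarrow> continuous_on UNIV (stage_cost G i t)"
  and A1_terminal_cont: "i \<ge> 1 \<Longrightarrow> continuous_on UNIV (terminal_cost G i)"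
  and A1_env_dyn: "t \<in> \<T> \<Longrightarrow> continuous_on UNIV (env_dyn G t)"
  and A1_env_map: "t \<in> \<T> \<Longrightarrow> continuous_on UNIV (env_map G t)"
  using A1 unfolding condition_A1_def by (elim conjE; fast)+

text \<open>(A1) identifies only the product sets; a product of nonempty sets determines its
  factors.\<close>

lemma policies_eq: "i \<ge> 1 \<Longrightarrow> t \<in> \<T> \<Longrightarrow> policies G i t = policies G 1 t"
  using A1_pure[of i] A1_policies[of i] A1_policies[of 1]
    PiE_eq_iff_not_empty[of \<T> "policies G i" "policies G 1"]
  unfolding pure_strategies_def by simp

lemma pure_policies: "i \<ge> 1 \<Longrightarrow> s \<in> pure_strategies G i \<Longrightarrow> t \<in> \<T> \<Longrightarrow> s t \<in> policies G 1 t"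
  using policies_eq[of i t] PiE_mem[of s \<T> "policies G i" t] unfolding pure_strategies_def by simp

lemma policies_equicontinuous:
  assumes "t \<in> \<T>"
  shows "uniformly_equicontinuous (policies G 1 t) apply_bcontfun"
proof (rule compact_bcontfun_equicontinuous)
  show "compact (policies G 1 t)" using assms by (simp add: A1_compact)
qed (intro compact_UNIV_prod compact_UNIV_fun)

text \<open>\<open>IH\<close> is the conclusion of \<open>dec_equicontinuous\<close> at
  \<open>t\<close>. Keeping it as a hypothesis lets the same argument serve inside that induction
  and, once the induction is finished, for the control at a given time \<open>t\<close>.\<close>

lemma u_dec_equicontinuous:
  assumes t: "t \<in> \<T>" and \<eta>: "\<eta> > 0"
    and IH: "\<And>\<eta>. \<eta> > 0 \<Longrightarrow> \<exists>\<delta>>0. \<forall>i\<ge>1. \<forall>s\<in>pure_strategies G i. \<forall>\<omega> z z'. (\<forall>k<t. dist (z k) (z' k) <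
      \<delta>) \<longrightarrow>
      (\<forall>k\<le>t. dist (x_dec G i s z \<omega> k) (x_dec G i s z' \<omega> k) < \<eta>) \<and>
      (\<forall>k<t. dist (u_dec G i s z \<omega> k) (u_dec G i s z' \<omega> k) < \<eta>)"
  shows "\<exists>\<delta>>0. \<forall>i\<ge>1. \<forall>s\<in>pure_strategies G i. \<forall>\<omega> z z'. (\<forall>k<t. dist (z k) (z' k) < \<delta>) \<longrightarrow>
      dist (u_dec G i s z \<omega> t) (u_dec G i s z' \<omega> t) < \<eta>"
proof -
  obtain \<rho> where \<rho>: "\<rho> > 0" "\<And>\<phi> h h'. \<phi> \<in> policies G 1 t \<Longrightarrow> dist h h' < \<rho> \<Longrightarrow>
    dist (apply_bcontfun \<phi> h) (apply_bcontfun \<phi> h') < \<eta>"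
    using policies_equicontinuous[OF t] \<eta> unfolding uniformly_equicontinuous_def by metis
  obtain \<delta> where \<delta>: "\<delta> > 0" "\<And>i s \<omega> z z' k. i \<ge> 1 \<Longrightarrow> s \<in> pure_strategies G i \<Longrightarrow>
    (\<forall>k<t. dist (z k) (z' k) < \<delta>) \<Longrightarrow>
      (\<forall>k\<le>t. dist (x_dec G i s z \<omega> k) (x_dec G i s z' \<omega> k) < \<rho>/8) \<and>
      (\<forall>k<t. dist (u_dec G i s z \<omega> k) (u_dec G i s z' \<omega> k) < \<rho>/8)"
    \<comment> \<open>Each of the three history components contributes at most twice its
      coordinatewise bound, so the total is at most six eighths of \<open>\<rho>\<close>. Beyond the
      cut-off both histories equal \<open>undefined\<close> and contribute nothing.\<close>
    using IH[of "\<rho>/8"] \<rho>(1) by (metis divide_pos_pos zero_less_numeral)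
  have "dist (u_dec G i s z \<omega> t) (u_dec G i s z' \<omega> t) < \<eta>"
    if i: "i \<ge> 1" and s: "s \<in> pure_strategies G i" and z: "\<forall>k<t. dist (z k) (z' k) < min \<delta> (\<rho>/8)"
      for i s \<omega> z z'
  proof -
    let ?x = "\<lambda>z k. if k \<le> t then x_dec G i s z \<omega> k else undefined"
    let ?u = "\<lambda>z k. if k < t then u_dec G i s z \<omega> k else undefined"
    let ?z = "\<lambda>z k. if k < t then z k else undefined"
    have z': "\<forall>k<t. dist (z k) (z' k) < \<delta>" using z by auto
    have "dist (?x z) (?x z') \<le> 2 * (\<rho>/8)" "dist (?u z) (?u z') \<le>
      2 * (\<rho>/8)" "dist (?z z) (?z z') \<le> 2 * (\<rho>/8)"
      using \<delta>(2)[OF i s z', of \<omega>] z \<rho>(1) by (intro dist_fun_le; simp add: less_imp_le)+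
    then have "dist (?x z, ?u z, ?z z) (?x z', ?u z', ?z z') \<le> 2 * (\<rho>/8) + (2 * (\<rho>/8) + 2 * (\<rho>/8))"
      by (intro order_trans[OF dist_Pair_le] add_mono)
    also have "\<dots> < \<rho>" using \<rho>(1) by simp
    finally show ?thesis
      unfolding u_dec.simps[of _ _ _ _ _ t] by (rule \<rho>(2)[OF pure_policies[OF i s t]])
  qed
  then show ?thesis using \<delta>(1) \<rho>(1) by (intro exI[of _ "min \<delta> (\<rho>/8)"]) auto
qed

text \<open>States are controlled up to \<open>t\<close> but controls only below \<open>t\<close>:
  when \<open>t\<close> is the horizon there is a final state and no control. Both responses see the
  same initial state and noise, which makes the modulus independent of the sample point.\<close>

lemma dec_equicontinuous:
  assumes "{..<t} \<subseteq> \<T>" "\<eta> > 0"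
  shows "\<exists>\<delta>>0. \<forall>i\<ge>1. \<forall>s\<in>pure_strategies G i. \<forall>\<omega> z z'. (\<forall>k<t. dist (z k) (z' k) < \<delta>) \<longrightarrow>
      (\<forall>k\<le>t. dist (x_dec G i s z \<omega> k) (x_dec G i s z' \<omega> k) < \<eta>) \<and>
      (\<forall>k<t. dist (u_dec G i s z \<omega> k) (u_dec G i s z' \<omega> k) < \<eta>)"
  using assms
proof (induction t arbitrary: \<eta>)
  case 0
  then show ?case by (intro exI[of _ 1]) (auto simp: x_dec.simps)
next
  case (Suc t)
  have t: "t \<in> \<T>" "{..<t} \<subseteq> \<T>" using Suc.prems by auto
  have IH: "\<And>\<eta>. \<eta> > 0 \<Longrightarrow> \<exists>\<delta>>0. \<forall>i\<ge>1. \<forall>s\<in>pure_strategies G i. \<forall>\<omega> z z'. (\<forall>k<t. dist (z k) (z' k) < \<delta>) \<longrightarrow>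
      (\<forall>k\<le>t. dist (x_dec G i s z \<omega> k) (x_dec G i s z' \<omega> k) < \<eta>) \<and>
      (\<forall>k<t. dist (u_dec G i s z \<omega> k) (u_dec G i s z' \<omega> k) < \<eta>)"
    using Suc.IH[OF t(2)] by blast
  have "uniformly_equicontinuous {1..} (\<lambda>i. dyn G i t)"
    by (rule A1_dyn[OF t(1)])
  then obtain \<rho> where \<rho>: "\<rho> > 0" "\<And>i h h'. i \<ge> 1 \<Longrightarrow> dist h h' < \<rho> \<Longrightarrow>
    dist (dyn G i t h) (dyn G i t h') < \<eta>"
    using Suc.prems(2) unfolding uniformly_equicontinuous_def by (metis atLeast_iff)
  \<comment> \<open>State, control and environment each move by less than \<open>\<rho>/4\<close>
    and the noise does not move, for a total below \<open>\<rho>\<close>.\<close>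
  define e where "e = min \<eta> (\<rho>/4)"
  have e: "e > 0" using \<rho>(1) Suc.prems(2) by (simp add: e_def)
  obtain \<delta> where \<delta>: "\<delta> > 0" "\<And>i s \<omega> z z' k. i \<ge> 1 \<Longrightarrow> s \<in> pure_strategies G i \<Longrightarrow>
    (\<forall>k<t. dist (z k) (z' k) < \<delta>) \<Longrightarrow>
      (\<forall>k\<le>t. dist (x_dec G i s z \<omega> k) (x_dec G i s z' \<omega> k) < e) \<and>
      (\<forall>k<t. dist (u_dec G i s z \<omega> k) (u_dec G i s z' \<omega> k) < e)"
    using IH[OF e] by metis
  obtain \<delta>' where \<delta>': "\<delta>' > 0" "\<And>i s \<omega> z z' k. i \<ge> 1 \<Longrightarrow> s \<in> pure_strategies G i \<Longrightarrow>
    (\<forall>k<t. dist (z k) (z' k) < \<delta>') \<Longrightarrow>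
      dist (u_dec G i s z \<omega> t) (u_dec G i s z' \<omega> t) < e"
    using u_dec_equicontinuous[OF t(1) e IH] by metis
  show ?case
  proof (intro exI[of _ "min (min \<delta> \<delta>') e"] conjI allI impI ballI)
    show "min (min \<delta> \<delta>') e > 0" using \<delta>(1) \<delta>'(1) e by simp
  next
    fix i :: nat and s \<omega> k and z z' :: "nat \<Rightarrow> 'y"
    assume i: "1 \<le> i" "s \<in> pure_strategies G i" and z: "\<forall>k<Suc t. dist (z k) (z' k) < min (min \<delta>
      \<delta>') e"
    have *: "\<forall>k\<le>t. dist (x_dec G i s z \<omega> k) (x_dec G i s z' \<omega> k) < e"
      "\<forall>k<t. dist (u_dec G i s z \<omega> k) (u_dec G i s z' \<omega> k) < e"
      "dist (u_dec G i s z \<omega> t) (u_dec G i s z' \<omega> t) < e"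
      using \<delta>(2)[OF i, of z z' \<omega>] \<delta>'(2)[OF i, of z z' \<omega>] z by auto
    show "dist (u_dec G i s z \<omega> k) (u_dec G i s z' \<omega> k) < \<eta>" if "k < Suc t"
      using * that less_Suc_eq[of k t] by (auto simp: e_def)
    show "dist (x_dec G i s z \<omega> k) (x_dec G i s z' \<omega> k) < \<eta>" if "k \<le> Suc t"
    proof (cases "k = Suc t")
      case True
      have "dist (x_dec G i s z \<omega> t, u_dec G i s z \<omega> t, z t, x_noise G i t \<omega>)
          (x_dec G i s z' \<omega> t, u_dec G i s z' \<omega> t, z' t, x_noise G i t \<omega>) \<le> e + (e + (e + 0))"
        using * z by (intro order_trans[OF dist_Pair_le] add_mono) auto
      also have "\<dots> < \<rho>" using \<rho>(1) by (simp add: e_def)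
      finally show ?thesis unfolding True x_dec.simps by (rule \<rho>(2)[OF i(1)])
    qed (use * that in \<open>auto simp: e_def\<close>)
  qed
qed

lemma lessThan_time_set: "t \<in> \<T> \<Longrightarrow> {..<t} \<subseteq> \<T>"
  by (auto intro: in_time_set_mono)

lemma control_equicontinuous:
  assumes t: "t \<in> \<T>" and \<eta>: "\<eta> > 0"
  shows "\<exists>\<delta>>0. \<forall>i\<ge>1. \<forall>s\<in>pure_strategies G i. \<forall>\<omega> z z'. (\<forall>k<t. dist (z k) (z' k) < \<delta>) \<longrightarrow>
      dist (x_dec G i s z \<omega> t) (x_dec G i s z' \<omega> t) < \<eta> \<and>
      dist (u_dec G i s z \<omega> t) (u_dec G i s z' \<omega> t) < \<eta>"
proof -
  obtain \<delta> where \<delta>: "\<delta> > 0" "\<forall>i\<ge>1. \<forall>s\<in>pure_strategies G i. \<forall>\<omega> z z'. (\<forall>k<t. dist (z k) (z' k) < \<delta>) \<longrightarrow>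
      (\<forall>k\<le>t. dist (x_dec G i s z \<omega> k) (x_dec G i s z' \<omega> k) < \<eta>) \<and>
      (\<forall>k<t. dist (u_dec G i s z \<omega> k) (u_dec G i s z' \<omega> k) < \<eta>)"
    using dec_equicontinuous[OF lessThan_time_set[OF t] \<eta>] by (elim exE conjE)
  obtain \<delta>' where \<delta>': "\<delta>' > 0" "\<forall>i\<ge>1. \<forall>s\<in>pure_strategies G i. \<forall>\<omega> z z'. (\<forall>k<t. dist (z k) (z' k) <
    \<delta>') \<longrightarrow>
      dist (u_dec G i s z \<omega> t) (u_dec G i s z' \<omega> t) < \<eta>"
    using u_dec_equicontinuous[OF t \<eta> dec_equicontinuous[OF lessThan_time_set[OF t]]] by blast
  show ?thesis
    using \<delta> \<delta>' by (intro exI[of _ "min \<delta> \<delta>'"]) simp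
qed

section \<open>Aggregates: a modulus common to all \<open>N\<close>, and the influence of one
  coordinate\<close>

lemma aggr_equicontinuous:
  assumes "t \<in> \<T>" "\<eta> > 0"
  obtains \<delta> where "\<delta> > 0" "\<And>N x u x' u'. N \<ge> 1 \<Longrightarrow> x \<in> extensional {1..N} \<Longrightarrow> u \<in> extensional {1..N} \<Longrightarrow>
    x' \<in> extensional {1..N} \<Longrightarrow> u' \<in> extensional {1..N} \<Longrightarrow>
    (\<And>j. j \<in> {1..N} \<Longrightarrow> dist (x j, u j) (x' j, u' j) < \<delta>) \<Longrightarrow>
    dist (aggr G N t x u) (aggr G N t x' u') < \<eta>"
proof -
  obtain \<delta> where \<delta>: "\<delta> > 0" "\<forall>N\<ge>1.
        \<forall>x\<in>{1..N} \<rightarrow>\<^sub>E UNIV. \<forall>u\<in>{1..N} \<rightarrow>\<^sub>E UNIV. \<forall>x'\<in>{1..N} \<rightarrow>\<^sub>E UNIV. \<forall>u'\<in>{1..N} \<rightarrow>\<^sub>E UNIV.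
          (SUP i\<in>{1..N}. dist (x i, u i) (x' i, u' i)) < \<delta>
            \<longrightarrow> dist (aggr G N t x u) (aggr G N t x' u') < \<eta>"
    using A2 assms unfolding condition_A2_def by meson
  show ?thesis
  proof (rule that[OF \<delta>(1)])
    fix N :: nat and x x' :: "nat \<Rightarrow> 'x" and u u' :: "nat \<Rightarrow> 'u"
    assume N: "N \<ge> 1" and ext: "x \<in> extensional {1..N}" "u \<in> extensional {1..N}"
      "x' \<in> extensional {1..N}" "u' \<in> extensional {1..N}"
      and d: "\<And>j. j \<in> {1..N} \<Longrightarrow> dist (x j, u j) (x' j, u' j) < \<delta>"
    \<comment> \<open>Over the finite nonempty index set the supremum is a maximum, so strict
      coordinatewise bounds remain strict.\<close>
    have "(SUP i\<in>{1..N}. dist (x i, u i) (x' i, u' i)) < \<delta>"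
      using N d by (subst cSup_eq_Max) auto
    then show "dist (aggr G N t x u) (aggr G N t x' u') < \<eta>"
      using \<delta>(2) N ext by (auto simp: PiE_def)
  qed
qed

lemma aggr_single:
  assumes "t \<in> \<T>" "\<eta> > 0"
  shows "\<forall>\<^sub>F N in sequentially. \<forall>i\<in>{1..N}. \<forall>x\<in>extensional {1..N}. \<forall>u\<in>extensional {1..N}.
    \<forall>x'\<in>extensional {1..N}. \<forall>u'\<in>extensional {1..N}.
    (\<forall>j\<in>{1..N} - {i}. x j = x' j \<and> u j = u' j) \<longrightarrow> dist (aggr G N t x u) (aggr G N t x' u') < \<eta>"
proof -
  define S where "S N i = {dist (aggr G N t x u) (aggr G N t x' u') | x u x' u'.
            x \<in> {1..N} \<rightarrow>\<^sub>E UNIV \<and> u \<in> {1..N} \<rightarrow>\<^sub>E UNIV \<and>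
            x' \<in> {1..N} \<rightarrow>\<^sub>E UNIV \<and> u' \<in> {1..N} \<rightarrow>\<^sub>E UNIV \<and>
            (\<forall>j\<in>{1..N} - {i}. (x j, u j) = (x' j, u' j))}" for N i
  have "(\<lambda>N. SUP i\<in>{1..N}. Sup (S N i)) \<longlonglongrightarrow> 0"
    using A2 assms(1) unfolding condition_A2_def S_def by blast
  then have ev: "\<forall>\<^sub>F N in sequentially. (SUP i\<in>{1..N}. Sup (S N i)) < \<eta>"
    using assms(2) by (rule order_tendstoD)
  \<comment> \<open>A real supremum dominates the members of a set only if the set is bounded above;
    compactness of the aggregate space gives this bound.\<close>
  have "bounded (UNIV :: 'd set)" by (rule compact_imp_bounded[OF compact_UNIV])
  then obtain B where B: "\<And>a b :: 'd. dist a b \<le> B"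
    by (metis UNIV_I bounded_two_points)
  show ?thesis
    using ev
  proof eventually_elim
    case (elim N)
    show ?case
    proof (intro ballI impI)
      fix i and x x' :: "nat \<Rightarrow> 'x" and u u' :: "nat \<Rightarrow> 'u"
      assume i: "i \<in> {1..N}" and ext: "x \<in> extensional {1..N}" "u \<in> extensional {1..N}"
        "x' \<in> extensional {1..N}" "u' \<in> extensional {1..N}" and eq: "\<forall>j\<in>{1..N} - {i}. x j = x' j \<and>
          u j = u' j"
      have "dist (aggr G N t x u) (aggr G N t x' u') \<in> S N i"
        unfolding S_def using ext eq by (simp add: PiE_def) blast
      moreover have "bdd_above (S N i)" by (rule bdd_aboveI[of _ B]) (auto simp: S_def B)
      ultimately have "dist (aggr G N t x u) (aggr G N t x' u') \<le> Sup (S N i)" by (rule cSup_upper)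
      also have "\<dots> \<le> (SUP i\<in>{1..N}. Sup (S N i))" using i by (intro cSUP_upper) auto
      finally show "dist (aggr G N t x u) (aggr G N t x' u') < \<eta>" using elim by simp
    qed
  qed
qed

subsection \<open>Negligible influence of a single decision maker\<close>

definition variant :: "nat \<Rightarrow> nat \<Rightarrow> (nat \<Rightarrow> ('x, 'u, 'y) strategy) \<Rightarrow> (nat \<Rightarrow> ('x, 'u,
  'y) strategy) \<Rightarrow> bool" where
  "variant N i s s' \<longleftrightarrow> i \<in> {1..N} \<and> (\<forall>j\<in>{1..N}. s j \<in> pure_strategies G j) \<and> (\<forall>j\<in>{1..N} -
    {i}. s' j = s j)"

lemma freeze_path:
  assumes "variant N i s s'" "j \<in> {1..N} - {i}"
  shows "x_path (freeze G i) N s' \<omega> j t = x_dec G j (s j) (y_path (freeze G i) N s' \<omega>) \<omega> t"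
    and "u_path (freeze G i) N s' \<omega> j t = u_dec G j (s j) (y_path (freeze G i) N s' \<omega>) \<omega> t"
  using assms by (simp_all add: path_eq_dec dec_freeze variant_def)

text \<open>The index shift follows the recursion: the environment state at \<open>t\<close> is
  known before the aggregate at \<open>t\<close>, while \<open>y_path\<close> at \<open>t\<close>
  requires that aggregate.\<close>

definition env_close :: "nat \<Rightarrow> real \<Rightarrow> nat \<Rightarrow> bool" where
  "env_close t \<eta> N \<longleftrightarrow> (\<forall>i s s' \<omega>. variant N i s s' \<longrightarrow>
    (\<forall>k<t. dist (y_path G N s \<omega> k) (y_path (freeze G i) N s' \<omega> k) < \<eta>) \<and>
    dist (env_path G N s \<omega> t) (env_path (freeze G i) N s' \<omega> t) < \<eta>)"

lemma aggr_close:
  assumes t: "t \<in> \<T>" and \<eta>: "\<eta> > 0"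
    and IH: "\<forall>\<eta>>0. \<forall>\<^sub>F N in sequentially. env_close t \<eta> N"
  shows "\<forall>\<^sub>F N in sequentially. \<forall>i s s' \<omega>. variant N i s s' \<longrightarrow>
    dist (aggr G N t (\<lambda>j\<in>{1..N}. x_path G N s \<omega> j t) (\<lambda>j\<in>{1..N}. u_path G N s \<omega> j t))
      (aggr G N t (\<lambda>j\<in>{1..N}. x_path (freeze G i) N s' \<omega> j t) (\<lambda>j\<in>{1..N}. u_path (freeze G i) N s'
        \<omega> j t)) < \<eta>"
proof -
  obtain \<rho> where \<rho>: "\<rho> > 0" "\<And>N x u x' u'. N \<ge> 1 \<Longrightarrow> x \<in> extensional {1..N} \<Longrightarrow> u \<in> extensional {1..N} \<Longrightarrow>
    x' \<in> extensional {1..N} \<Longrightarrow> u' \<in> extensional {1..N} \<Longrightarrow>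
    (\<And>j. j \<in> {1..N} \<Longrightarrow> dist (x j, u j) (x' j, u' j) < \<rho>) \<Longrightarrow>
    dist (aggr G N t x u) (aggr G N t x' u') < \<eta> / 2"
    using aggr_equicontinuous[OF t, of "\<eta> / 2"] \<eta> by (metis half_gt_zero)
  have r4: "\<rho> / 4 > 0" using \<rho>(1) by simp
  obtain \<delta> where \<delta>: "\<delta> > 0" "\<And>i s \<omega> z z'. i \<ge> 1 \<Longrightarrow> s \<in> pure_strategies G i \<Longrightarrow>
    (\<forall>k<t. dist (z k) (z' k) < \<delta>) \<Longrightarrow>
      dist (x_dec G i s z \<omega> t) (x_dec G i s z' \<omega> t) < \<rho> / 4 \<and>
        dist (u_dec G i s z \<omega> t) (u_dec G i s z' \<omega> t) < \<rho> / 4"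
    using control_equicontinuous[OF t r4] by (elim exE conjE) (rule that, assumption, blast)
  have "\<eta> / 2 > 0" using \<eta> by auto
  show ?thesis
    using IH[rule_format, OF \<delta>(1)] aggr_single[OF t \<open>\<eta> / 2 > 0\<close>]
  proof eventually_elim
    case (elim N)
    show ?case
    proof (intro allI impI)
      fix i s s' \<omega> assume v: "variant N i s s'"
      then have i: "i \<in> {1..N}" by (simp add: variant_def)
      let ?y = "y_path G N s \<omega>" and ?y' = "y_path (freeze G i) N s' \<omega>"
      let ?x = "\<lambda>j\<in>{1..N}. x_path G N s \<omega> j t" and ?u = "\<lambda>j\<in>{1..N}. u_path G N s \<omega> j t"
      let ?x' = "\<lambda>j\<in>{1..N}. x_path (freeze G i) N s' \<omega> j t" and ?u' =
        "\<lambda>j\<in>{1..N}. u_path (freeze G i) N s' \<omega> j t"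
      let ?x'' = "?x(i := ?x' i)" and ?u'' = "?u(i := ?u' i)"
      have ext: "?x'' \<in> extensional {1..N}" "?u'' \<in> extensional {1..N}"
        using i by (auto simp: extensional_def)
      have y: "\<forall>k<t. dist (?y k) (?y' k) < \<delta>"
        using elim(1) v unfolding env_close_def by blast
      have "dist (aggr G N t ?x ?u) (aggr G N t ?x'' ?u'') < \<eta> / 2"
        by (rule elim(2)[rule_format]) (use i ext in auto)
      moreover have "dist (aggr G N t ?x'' ?u'') (aggr G N t ?x' ?u') < \<eta> / 2"
      proof (rule \<rho>(2))
        fix j assume j: "j \<in> {1..N}"
        show "dist (?x'' j, ?u'' j) (?x' j, ?u' j) < \<rho>"
        proof (cases "j = i")
          case False
          with j have j': "j \<in> {1..N} - {i}" "j \<ge> 1" and s: "s j \<in> pure_strategies G j"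
            using v by (auto simp: variant_def)
          have "dist (x_path G N s \<omega> j t) (x_path (freeze G i) N s' \<omega> j t) < \<rho> / 4"
            "dist (u_path G N s \<omega> j t) (u_path (freeze G i) N s' \<omega> j t) < \<rho> / 4"
            unfolding freeze_path[OF v j'(1)] x_path_eq_dec[of G N s] u_path_eq_dec[of G N s]
            using \<delta>(2)[OF j'(2) s y] by blast+
          then show ?thesis
            using False j \<rho>(1) dist_Pair_le[of "?x j" "?u j" "?x' j" "?u' j"] by simp
        qed (use j \<rho>(1) in simp)
      qed (use i ext in auto)
      ultimately have "dist (aggr G N t ?x ?u) (aggr G N t ?x'' ?u'') + dist (aggr G N t ?x''
        ?u'') (aggr G N t ?x' ?u') < \<eta>"
        by linarith
      then show "dist (aggr G N t ?x ?u) (aggr G N t ?x' ?u') < \<eta>"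
        by (rule le_less_trans[OF dist_triangle])
    qed
  qed
qed

lemma y_close:
  assumes t: "t \<in> \<T>" and \<eta>: "\<eta> > 0"
    and IH: "\<forall>\<eta>>0. \<forall>\<^sub>F N in sequentially. env_close t \<eta> N"
  shows "\<forall>\<^sub>F N in sequentially. \<forall>i s s' \<omega>. variant N i s s' \<longrightarrow>
      dist (y_path G N s \<omega> t) (y_path (freeze G i) N s' \<omega> t) < \<eta> \<and>
      dist (env_path G N s \<omega> (Suc t)) (env_path (freeze G i) N s' \<omega> (Suc t)) < \<eta>"
proof -
  obtain d1 where d1: "d1 > 0" "\<And>h h'. dist h h' < d1 \<Longrightarrow> dist (env_map G t h) (env_map G t h') < \<eta>"
    using compact_space_uniform[OF _ A1_env_map[OF t] \<eta>,
      OF compact_UNIV_prod[OF compact_UNIV compact_UNIV_prod[OF compact_UNIV compact_UNIV]]] by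
      blast
  obtain d2 where d2: "d2 > 0" "\<And>h h'. dist h h' < d2 \<Longrightarrow> dist (env_dyn G t h) (env_dyn G t h') < \<eta>"
    using compact_space_uniform[OF _ A1_env_dyn[OF t] \<eta>,
      OF compact_UNIV_prod[OF compact_UNIV compact_UNIV_prod[OF compact_UNIV compact_UNIV]]] by
      blast
  \<comment> \<open>Environment state and aggregate each move by less than \<open>e\<close>, and the
    noise is common to both games, so the total stays below both moduli.\<close>
  define e where "e = min d1 d2 / 4"
  have e: "e > 0" using d1(1) d2(1) by (simp add: e_def)
  show ?thesis
    using IH[rule_format, OF e] aggr_close[OF t e IH]
  proof eventually_elim
    case (elim N)
    show ?case
    proof (intro allI impI)
      fix i s s' \<omega> assume v: "variant N i s s'"
      define D where "D = aggr G N t (\<lambda>j\<in>{1..N}. x_path G N s \<omega> j t) (\<lambda>j\<in>{1..N}. u_path G N s \<omega> j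
        t)"
      define D' where "D' = aggr G N t (\<lambda>j\<in>{1..N}. x_path (freeze G i) N s' \<omega> j t) (\<lambda>j\<in>{1..N}.
        u_path (freeze G i) N s' \<omega> j t)"
      have D: "dist D D' < e" unfolding D_def D'_def using elim(2) v by blast
      have E: "dist (env_path G N s \<omega> t) (env_path (freeze G i) N s' \<omega> t) < e"
        using elim(1) v unfolding env_close_def by blast
      have *: "dist (env_path G N s \<omega> t, D, c) (env_path (freeze G i) N s' \<omega> t, D', c) \<le>
        e + (e + 0)" for c :: "'z::metric_space"
        using D E by (intro order_trans[OF dist_Pair_le] add_mono) auto
      have "e + (e + 0) < d1" "e + (e + 0) < d2" using d1(1) d2(1) by (auto simp: e_def)
      then show "dist (y_path G N s \<omega> t) (y_path (freeze G i) N s' \<omega> t) < \<eta> \<and>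
          dist (env_path G N s \<omega> (Suc t)) (env_path (freeze G i) N s' \<omega> (Suc t)) < \<eta>"
        unfolding y_path.simps[of _ _ _ _ t] env_path.simps D_def[symmetric] freeze_sel
          D'_def[symmetric]
        by (intro conjI d1(2) d2(2) le_less_trans[OF *])
    qed
  qed
qed

text \<open>The threshold for \<open>N\<close> depends on \<open>t\<close>, which is why closeness
  is claimed on one finite window at a time.\<close>

lemma env_close_eventually:
  assumes "{..<t} \<subseteq> \<T>" "\<eta> > 0"
  shows "\<forall>\<^sub>F N in sequentially. env_close t \<eta> N"
  using assms
proof (induction t arbitrary: \<eta>)
  case 0
  then show ?case by (auto simp: env_close_def env_path.simps)
next
  case (Suc t)
  have t: "t \<in> \<T>" using Suc.prems by auto
  have IH: "\<forall>\<eta>>0. \<forall>\<^sub>F N in sequentially. env_close t \<eta> N" using Suc.IH Suc.prems(1) by (simp add: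
    lessThan_Suc)
  show ?case
    using IH[rule_format, OF Suc.prems(2)] y_close[OF t Suc.prems(2) IH]
    by eventually_elim (auto simp: env_close_def less_Suc_eq)
qed

subsection \<open>Continuity of the discounted cost\<close>

lemma cost_constants:
  obtains C b where "C > 0" "0 < b" "b < 1"
    "\<And>i t h. i \<ge> 1 \<Longrightarrow> t \<in> \<T> \<Longrightarrow> \<bar>stage_cost G i t h\<bar> \<le> C" "\<And>i x. i \<ge> 1 \<Longrightarrow> \<bar>terminal_cost G i x\<bar> \<le> C"
    "\<And>i. i \<ge> 1 \<Longrightarrow> 0 < discount G i \<and> discount G i \<le> b"
proof -
  have d: "\<And>i. i \<ge> 1 \<Longrightarrow> 0 < discount G i \<and> discount G i \<le> 1"
    using setting unfolding game_setting_def by fast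
  have bdd: "bdd_above (discount G ` {1..})" by (rule bdd_aboveI[of _ 1]) (use d in auto)
  obtain b where b: "b < 1" "(SUP i\<in>{1..}. discount G i) < b"
    using A1 unfolding condition_A1_def by (elim conjE exE)
  have b': "discount G i \<le> b" if "i \<ge> 1" for i
    using cSUP_upper[OF _ bdd, of i] b(2) that by simp
  obtain C where C: "\<forall>i\<ge>1. \<forall>t\<in>\<T>. \<forall>x u y. \<bar>stage_cost G i t (x, u,
    y)\<bar> < C" "\<forall>i\<ge>1. \<forall>x. \<bar>terminal_cost G i x\<bar> < C"
    using A1 unfolding condition_A1_def by (elim conjE exE)
  show ?thesis
  proof (rule that[of C b])
    show "C > 0" using C(2)[rule_format, of 1 undefined] by simp
    show "0 < b" using b'[of 1] d[of 1] by simp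
    show "\<bar>stage_cost G i t h\<bar> \<le> C" if "i \<ge> 1" "t \<in> \<T>" for i t h
      using C(1)[rule_format, OF that, of "fst h" "fst (snd h)" "snd (snd h)"] by simp
    show "\<bar>terminal_cost G i x\<bar> \<le> C" if "i \<ge> 1" for i x
      using C(2)[rule_format, OF that, of x] by simp
  qed (use b b' d in auto)
qed

definition stage_term :: "nat \<Rightarrow> (nat \<Rightarrow> 'x) \<Rightarrow> (nat \<Rightarrow> 'u) \<Rightarrow> (nat \<Rightarrow> 'y) \<Rightarrow> nat \<Rightarrow> real" where
  "stage_term i x u y t = (if t \<in> \<T> then discount G i ^ t * stage_cost G i t (x t, u t,
    y t) else 0)"

definition terminal_term :: "nat \<Rightarrow> (nat \<Rightarrow> 'x) \<Rightarrow> real" where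
  "terminal_term i x = (case horizon G of enat n \<Rightarrow> discount G i ^ n * terminal_cost G i (x n) | \<infinity>
    \<Rightarrow> 0)"

lemma discounted_cost_eq: "discounted_cost G i x u y = suminf (stage_term i x u y) + terminal_term
  i x"
  by (simp add: discounted_cost_def stage_term_def[abs_def] terminal_term_def)

lemma abs_le_power:
  fixes c :: real
  assumes "0 < d" "d \<le> b" "b < 1" "\<bar>c\<bar> \<le> C"
  shows "\<bar>d ^ t * c\<bar> \<le> C * b ^ t"
  using assms mult_mono[of "d ^ t" "b ^ t" "\<bar>c\<bar>" C] by (simp add: abs_mult power_mono mult.commute)

lemma cost_bounded: "\<exists>B. \<forall>i\<ge>1. \<forall>x u y. \<bar>discounted_cost G i x u y\<bar> \<le> B"
proof -
  from cost_constants obtain C b where C: "C > 0" "0 < b" "b < 1"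
    "\<And>i t h. i \<ge> 1 \<Longrightarrow> t \<in> \<T> \<Longrightarrow> \<bar>stage_cost G i t h\<bar> \<le> C" "\<And>i x. i \<ge> 1 \<Longrightarrow> \<bar>terminal_cost G i x\<bar> \<le> C"
    "\<And>i. i \<ge> 1 \<Longrightarrow> 0 < discount G i \<and> discount G i \<le> b" by blast
  have sm: "summable (\<lambda>t. C * b ^ t)" using C by (intro summable_mult summable_geometric) auto
  have "\<bar>discounted_cost G i x u y\<bar> \<le> (\<Sum>t. C * b ^ t) + C" if i: "i \<ge> 1" for i x u y
  proof -
    have 1: "norm (stage_term i x u y t) \<le> C * b ^ t" for t
      using abs_le_power[of "discount G i" b "stage_cost G i t (x t, u t,
        y t)" C t] C i by (simp add: stage_term_def)
    have "norm (suminf (stage_term i x u y)) \<le> (\<Sum>t. C * b ^ t)"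
      by (rule norm_suminf_le[OF 1 sm])
    moreover have "\<bar>terminal_term i x\<bar> \<le> C"
    proof (cases "horizon G")
      case (enat n)
      then have "\<bar>terminal_term i x\<bar> \<le> C * b ^ n"
        using abs_le_power[of "discount G i" b "terminal_cost G i (x n)" C n] C i by (simp add:
          terminal_term_def)
      also have "\<dots> \<le> C * 1" using C by (intro mult_left_mono power_le_one) auto
      finally show ?thesis by simp
    qed (use C in \<open>simp add: terminal_term_def\<close>)
    ultimately show ?thesis unfolding discounted_cost_eq by simp
  qed
  then show ?thesis by blast
qed

text \<open>The stage cost at \<open>t\<close> reads \<open>z t\<close> directly, so closeness is
  required up to and including \<open>t\<close>, one time further than for the state and control.
  Discount factors are at most 1 and do not enlarge the difference.\<close>

lemma stage_close:
  assumes t: "t \<in> \<T>" and \<eta>: "\<eta> > 0"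
  shows "\<exists>\<delta>>0. \<forall>i\<ge>1. \<forall>s\<in>pure_strategies G i. \<forall>\<omega> z z'. (\<forall>k\<le>t. dist (z k) (z' k) < \<delta>) \<longrightarrow>
    \<bar>stage_term i (x_dec G i s z \<omega>) (u_dec G i s z \<omega>) z t -
      stage_term i (x_dec G i s z' \<omega>) (u_dec G i s z' \<omega>) z' t\<bar> < \<eta>"
proof -
  obtain \<rho> where \<rho>: "\<rho> > 0" "\<And>i h h'. i \<ge> 1 \<Longrightarrow> dist h h' < \<rho> \<Longrightarrow>
    dist (stage_cost G i t h) (stage_cost G i t h') < \<eta>"
    using A1_cost[OF t] \<eta> unfolding uniformly_equicontinuous_def by (metis atLeast_iff)
  have r4: "\<rho> / 4 > 0" using \<rho>(1) by simp
  obtain \<delta> where \<delta>: "\<delta> > 0" "\<And>i s \<omega> z z'. i \<ge> 1 \<Longrightarrow> s \<in> pure_strategies G i \<Longrightarrow>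
    (\<forall>k<t. dist (z k) (z' k) < \<delta>) \<Longrightarrow>
      dist (x_dec G i s z \<omega> t) (x_dec G i s z' \<omega> t) < \<rho> / 4 \<and>
        dist (u_dec G i s z \<omega> t) (u_dec G i s z' \<omega> t) < \<rho> / 4"
    using control_equicontinuous[OF t r4] by (elim exE conjE) (rule that, assumption, blast)
  show ?thesis
  proof (intro exI[of _ "min \<delta> (\<rho> / 4)"] conjI allI impI ballI)
    show "min \<delta> (\<rho> / 4) > 0" using \<delta>(1) \<rho>(1) by simp
  next
    fix i :: nat and s \<omega> and z z' :: "nat \<Rightarrow> 'y"
    assume i: "1 \<le> i" and s: "s \<in> pure_strategies G i" and z: "\<forall>k\<le>t. dist (z k) (z' k) < min \<delta> (\<rho>
      / 4)"
    let ?c = "stage_cost G i t (x_dec G i s z \<omega> t, u_dec G i s z \<omega> t, z t)"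
    let ?c' = "stage_cost G i t (x_dec G i s z' \<omega> t, u_dec G i s z' \<omega> t, z' t)"
    have "dist (x_dec G i s z \<omega> t, u_dec G i s z \<omega> t, z t) (x_dec G i s z' \<omega> t,
      u_dec G i s z' \<omega> t, z' t) \<le> \<rho>/4 + (\<rho>/4 + \<rho>/4)"
      using \<delta>(2)[OF i s, of z z' \<omega>] z
      by (intro order_trans[OF dist_Pair_le] add_mono) auto
    also have "\<dots> < \<rho>" using \<rho>(1) by simp
    finally have c: "\<bar>?c - ?c'\<bar> < \<eta>" using \<rho>(2)[OF i] by (simp add: dist_real_def)
    have d: "0 < discount G i" "discount G i \<le> 1"
      using setting i unfolding game_setting_def by fast+
    have "\<bar>discount G i ^ t * (?c - ?c')\<bar> \<le> 1 * \<bar>?c - ?c'\<bar>"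
      unfolding abs_mult using d by (intro mult_right_mono) (auto simp: power_le_one)
    then show "\<bar>stage_term i (x_dec G i s z \<omega>) (u_dec G i s z \<omega>) z t -
      stage_term i (x_dec G i s z' \<omega>) (u_dec G i s z' \<omega>) z' t\<bar> < \<eta>"
      using c t by (simp add: stage_term_def right_diff_distrib)
  qed
qed

lemma stage_sum_close:
  assumes K: "{..<K} \<subseteq> \<T>" and \<eta>: "\<eta> > 0"
  shows "\<exists>\<delta>>0. \<forall>i\<ge>1. \<forall>s\<in>pure_strategies G i. \<forall>\<omega> z z'. (\<forall>k<K. dist (z k) (z' k) < \<delta>) \<longrightarrow>
    \<bar>\<Sum>t<K. stage_term i (x_dec G i s z \<omega>) (u_dec G i s z \<omega>) z t -
      stage_term i (x_dec G i s z' \<omega>) (u_dec G i s z' \<omega>) z' t\<bar> < \<eta>"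
  using K \<eta>
proof (induction K arbitrary: \<eta>)
  case 0
  then show ?case by (auto intro: exI[of _ 1])
next
  case (Suc K)
  have "\<eta> / 2 > 0" using Suc.prems by simp
  obtain \<delta> where \<delta>: "\<delta> > 0" "\<And>i s \<omega> z z'. i \<ge> 1 \<Longrightarrow> s \<in> pure_strategies G i \<Longrightarrow>
    (\<forall>k<K. dist (z k) (z' k) < \<delta>) \<Longrightarrow>
    \<bar>\<Sum>t<K. stage_term i (x_dec G i s z \<omega>) (u_dec G i s z \<omega>) z t -
      stage_term i (x_dec G i s z' \<omega>) (u_dec G i s z' \<omega>) z' t\<bar> < \<eta> / 2"
    using Suc.IH[OF subset_trans[OF _ Suc.prems(1)] \<open>\<eta> / 2 > 0\<close>,
      OF lessThan_subset_iff[THEN iffD2, OF le_SucI[OF order_refl]]] by (elim exE conjE) (rule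
      that, assumption, blast)
  obtain \<delta>' where \<delta>': "\<delta>' > 0" "\<And>i s \<omega> z z'. i \<ge> 1 \<Longrightarrow> s \<in> pure_strategies G i \<Longrightarrow>
    (\<forall>k\<le>K. dist (z k) (z' k) < \<delta>') \<Longrightarrow>
    \<bar>stage_term i (x_dec G i s z \<omega>) (u_dec G i s z \<omega>) z K -
      stage_term i (x_dec G i s z' \<omega>) (u_dec G i s z' \<omega>) z' K\<bar> < \<eta> / 2"
    using stage_close[OF subsetD[OF Suc.prems(1) lessThan_iff[THEN iffD2,
      OF lessI]] \<open>\<eta> / 2 > 0\<close>] by (elim exE conjE) (rule that, assumption, blast)
  show ?case
  proof (intro exI[of _ "min \<delta> \<delta>'"] conjI allI impI ballI)
    fix i :: nat and s \<omega> and z z' :: "nat \<Rightarrow> 'y"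
    assume i: "1 \<le> i" and s: "s \<in> pure_strategies G i" and z: "\<forall>k<Suc K. dist (z k) (z' k) < min \<delta>
      \<delta>'"
    show "\<bar>\<Sum>t<Suc K. stage_term i (x_dec G i s z \<omega>) (u_dec G i s z \<omega>) z t -
      stage_term i (x_dec G i s z' \<omega>) (u_dec G i s z' \<omega>) z' t\<bar> < \<eta>"
    proof -
      have "\<forall>k<K. dist (z k) (z' k) < \<delta>" "\<forall>k\<le>K. dist (z k) (z' k) < \<delta>'" using z by auto
      from \<delta>(2)[OF i s this(1), of \<omega>] \<delta>'(2)[OF i s this(2), of \<omega>] show ?thesis
        unfolding sum.lessThan_Suc by linarith
    qed
  qed (use \<delta>(1) \<delta>'(1) in auto)
qed

text \<open>For a finite horizon the window has to be the horizon itself: the tail is then zero and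
  the terminal state depends on exactly the entries below \<open>K\<close>. For an infinite horizon
  \<open>K\<close> comes from the geometric bound that is uniform in \<open>i\<close>.\<close>

lemma stage_tail:
  assumes "\<eta> > 0"
  obtains K where "{..<K} \<subseteq> \<T>" "\<forall>n. horizon G = enat n \<longrightarrow> K = n"
    "\<And>i x u y. i \<ge> 1 \<Longrightarrow> summable (stage_term i x u y)"
    "\<And>i x u y. i \<ge> 1 \<Longrightarrow> \<bar>\<Sum>t. stage_term i x u y (t + K)\<bar> \<le> \<eta>"
proof -
  from cost_constants obtain C b where C: "C > 0" "0 < b" "b < 1"
    "\<And>i t h. i \<ge> 1 \<Longrightarrow> t \<in> \<T> \<Longrightarrow> \<bar>stage_cost G i t h\<bar> \<le> C" "\<And>i x. i \<ge> 1 \<Longrightarrow> \<bar>terminal_cost G i x\<bar> \<le> C"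
    "\<And>i. i \<ge> 1 \<Longrightarrow> 0 < discount G i \<and> discount G i \<le> b" by blast
  have sm: "summable (\<lambda>t. C * b ^ t)" using C by (intro summable_mult summable_geometric) auto
  have 1: "norm (stage_term i x u y t) \<le> C * b ^ t" if "i \<ge> 1" for i x u y t
    using abs_le_power[of "discount G i" b "stage_cost G i t (x t, u t,
      y t)" C t] C that by (simp add: stage_term_def)
  have sm': "summable (stage_term i x u y)" if "i \<ge> 1" for i x u y
    by (rule summable_comparison_test'[OF sm, of 0]) (rule 1[OF that])
  show ?thesis
  proof (cases "horizon G")
    case (enat n)
    have "stage_term i x u y (t + n) = 0" for i x u y t
      by (simp add: stage_term_def time_set_def enat)
    then show ?thesis
      by (intro that[of n] sm') (use assms enat in \<open>auto simp: time_set_def\<close>)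
  next
    case infinity
    obtain K where K: "norm (\<Sum>t. C * b ^ (t + K)) < \<eta>"
      using suminf_exist_split[OF assms sm] by blast
    have "\<bar>\<Sum>t. stage_term i x u y (t + K)\<bar> \<le> \<eta>" if "i \<ge> 1" for i x u y
    proof -
      have sK: "summable (\<lambda>t. C * b ^ (t + K))" using sm by (rule summable_ignore_initial_segment)
      have "norm (\<Sum>t. stage_term i x u y (t + K)) \<le> (\<Sum>t. C * b ^ (t + K))"
        by (rule norm_suminf_le[OF 1[OF that] sK])
      then show ?thesis using K by simp
    qed
    then show ?thesis
      by (intro that[of K] sm') (use infinity in \<open>auto simp: time_set_def\<close>)
  qed
qed

lemma terminal_close:
  assumes K: "{..<K} \<subseteq> \<T>" "\<forall>n. horizon G = enat n \<longrightarrow> K = n" and \<eta>: "\<eta> > 0"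
  shows "\<exists>\<delta>>0. \<forall>i\<ge>1. \<forall>s\<in>pure_strategies G i. \<forall>\<omega> z z'. (\<forall>k<K. dist (z k) (z' k) < \<delta>) \<longrightarrow>
    \<bar>terminal_term i (x_dec G i s z \<omega>) - terminal_term i (x_dec G i s z' \<omega>)\<bar> < \<eta>"
proof (cases "horizon G")
  case (enat n)
  obtain \<rho> where \<rho>: "\<rho> > 0" "\<And>i h h'. i \<ge> 1 \<Longrightarrow> dist h h' < \<rho> \<Longrightarrow>
    dist (terminal_cost G i h) (terminal_cost G i h') < \<eta>"
    using A1_terminal \<eta> unfolding uniformly_equicontinuous_def by (metis atLeast_iff)
  obtain \<delta> where \<delta>: "\<delta> > 0" "\<And>i s \<omega> z z'. i \<ge> 1 \<Longrightarrow> s \<in> pure_strategies G i \<Longrightarrow>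
    (\<forall>k<K. dist (z k) (z' k) < \<delta>) \<Longrightarrow>
      dist (x_dec G i s z \<omega> K) (x_dec G i s z' \<omega> K) < \<rho>"
    using dec_equicontinuous[OF K(1) \<rho>(1)] by (elim exE conjE) (rule that, assumption, blast)
  have "\<bar>terminal_term i (x_dec G i s z \<omega>) - terminal_term i (x_dec G i s z' \<omega>)\<bar> < \<eta>"
    if i: "1 \<le> i" and s: "s \<in> pure_strategies G i" and z: "\<forall>k<K. dist (z k) (z' k) < \<delta>" for i s \<omega>
      and z z' :: "nat \<Rightarrow> 'y"
  proof -
    let ?c = "terminal_cost G i (x_dec G i s z \<omega> K)"
    let ?c' = "terminal_cost G i (x_dec G i s z' \<omega> K)"
    have c: "\<bar>?c - ?c'\<bar> < \<eta>" using \<rho>(2)[OF i \<delta>(2)[OF i s z]] by (simp add: dist_real_def)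
    have d: "0 < discount G i" "discount G i \<le> 1"
      using setting i unfolding game_setting_def by fast+
    have "\<bar>discount G i ^ K * (?c - ?c')\<bar> \<le> 1 * \<bar>?c - ?c'\<bar>"
      unfolding abs_mult using d by (intro mult_right_mono) (auto simp: power_le_one)
    then show ?thesis using c enat K(2)[rule_format, OF enat] by (simp add: terminal_term_def
      right_diff_distrib)
  qed
  with \<delta>(1) show ?thesis by blast
qed (use \<eta> in \<open>auto simp: terminal_term_def intro: exI[of _ 1]\<close>)

lemma cost_close:
  assumes \<eta>: "\<eta> > 0"
  obtains K \<delta> where "{..<K} \<subseteq> \<T>" "\<delta> > 0"
    "\<And>i s \<omega> z z'. i \<ge> 1 \<Longrightarrow> s \<in> pure_strategies G i \<Longrightarrow> (\<forall>k<K. dist (z k) (z' k) < \<delta>) \<Longrightarrow>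
      \<bar>discounted_cost G i (x_dec G i s z \<omega>) (u_dec G i s z \<omega>) z
        - discounted_cost G i (x_dec G i s z' \<omega>) (u_dec G i s z' \<omega>) z'\<bar> \<le> \<eta>"
proof -
  \<comment> \<open>One quarter each for the initial sums, the two tails and the terminal
    costs.\<close>
  have \<eta>4: "\<eta> / 4 > 0" using \<eta> by simp
  obtain K where K: "{..<K} \<subseteq> \<T>" "\<forall>n. horizon G = enat n \<longrightarrow> K = n"
    "\<And>i x u y. i \<ge> 1 \<Longrightarrow> summable (stage_term i x u y)"
    "\<And>i x u y. i \<ge> 1 \<Longrightarrow> \<bar>\<Sum>t. stage_term i x u y (t + K)\<bar> \<le> \<eta> / 4"
    using stage_tail[OF \<eta>4] by blast
  obtain \<delta> where \<delta>: "\<delta> > 0" "\<And>i s \<omega> z z'. i \<ge> 1 \<Longrightarrow> s \<in> pure_strategies G i \<Longrightarrow>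
    (\<forall>k<K. dist (z k) (z' k) < \<delta>) \<Longrightarrow>
    \<bar>\<Sum>t<K. stage_term i (x_dec G i s z \<omega>) (u_dec G i s z \<omega>) z t -
      stage_term i (x_dec G i s z' \<omega>) (u_dec G i s z' \<omega>) z' t\<bar> < \<eta> / 4"
    using stage_sum_close[OF K(1) \<eta>4] by (elim exE conjE) (rule that, assumption, blast)
  obtain \<delta>' where \<delta>': "\<delta>' > 0" "\<And>i s \<omega> z z'. i \<ge> 1 \<Longrightarrow> s \<in> pure_strategies G i \<Longrightarrow>
    (\<forall>k<K. dist (z k) (z' k) < \<delta>') \<Longrightarrow>
    \<bar>terminal_term i (x_dec G i s z \<omega>) - terminal_term i (x_dec G i s z' \<omega>)\<bar> < \<eta> / 4"
    using terminal_close[OF K(1,2) \<eta>4] by (elim exE conjE) (rule that, assumption, blast)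
  show ?thesis
  proof (rule that[of K "min \<delta> \<delta>'"])
    fix i :: nat and s \<omega> and z z' :: "nat \<Rightarrow> 'y"
    assume i: "1 \<le> i" and s: "s \<in> pure_strategies G i" and z: "\<forall>k<K. dist (z k) (z' k) < min \<delta> \<delta>'"
    let ?a = "stage_term i (x_dec G i s z \<omega>) (u_dec G i s z \<omega>) z"
    let ?a' = "stage_term i (x_dec G i s z' \<omega>) (u_dec G i s z' \<omega>) z'"
    have "suminf ?a = (\<Sum>t. ?a (t + K)) + sum ?a {..<K}" "suminf ?a' =
      (\<Sum>t. ?a' (t + K)) + sum ?a' {..<K}"
      by (rule suminf_split_initial_segment[OF K(3)[OF i]])+
    moreover have "\<bar>\<Sum>t. ?a (t + K)\<bar> \<le> \<eta> / 4" "\<bar>\<Sum>t. ?a' (t + K)\<bar> \<le> \<eta> / 4"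
      by (rule K(4)[OF i])+
    moreover have "\<bar>sum ?a {..<K} - sum ?a' {..<K}\<bar> < \<eta> / 4"
      using \<delta>(2)[OF i s, of z z' \<omega>] z by (simp add: sum_subtractf)
    moreover have "\<bar>terminal_term i (x_dec G i s z \<omega>) - terminal_term i (x_dec G i s z' \<omega>)\<bar> < \<eta> / 4"
      using \<delta>'(2)[OF i s, of z z' \<omega>] z by simp
    ultimately show "\<bar>discounted_cost G i (x_dec G i s z \<omega>) (u_dec G i s z \<omega>) z
        - discounted_cost G i (x_dec G i s z' \<omega>) (u_dec G i s z' \<omega>) z'\<bar> \<le> \<eta>"
      unfolding discounted_cost_eq by linarith
  qed (use K(1) \<delta>(1) \<delta>'(1) in auto)
qed

text \<open>The environment runs on \<omega> and the response on a separate \<omega>'. With equal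
  sample points this compares costs inside the game; with \<omega>' integrated separately it
  compares the costs \<open>J_dec\<close> against the two environments. Likewise \<open>p\<close>
  need not be the strategy that produced the environment.\<close>

lemma game_cost_close:
  assumes \<eta>: "\<eta> > 0"
  shows "\<forall>\<^sub>F N in sequentially. \<forall>i s s' p \<omega> \<omega>'. variant N i s s' \<longrightarrow> p \<in> pure_strategies G i \<longrightarrow>
    \<bar>discounted_cost G i (x_dec G i p (y_path G N s \<omega>) \<omega>') (u_dec G i p (y_path G N s \<omega>) \<omega>')
      (y_path G N s \<omega>)
      - discounted_cost G i (x_dec G i p (y_path (freeze G i) N s' \<omega>) \<omega>')
          (u_dec G i p (y_path (freeze G i) N s' \<omega>) \<omega>') (y_path (freeze G i) N s' \<omega>)\<bar> \<le> \<eta>"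
proof -
  obtain K \<delta> where K: "{..<K} \<subseteq> \<T>" "\<delta> > 0"
    "\<And>i s \<omega> z z'. i \<ge> 1 \<Longrightarrow> s \<in> pure_strategies G i \<Longrightarrow> (\<forall>k<K. dist (z k) (z' k) < \<delta>) \<Longrightarrow>
      \<bar>discounted_cost G i (x_dec G i s z \<omega>) (u_dec G i s z \<omega>) z
        - discounted_cost G i (x_dec G i s z' \<omega>) (u_dec G i s z' \<omega>) z'\<bar> \<le> \<eta>"
    using cost_close[OF \<eta>] by blast
  show ?thesis
    using env_close_eventually[OF K(1,2)]
  proof eventually_elim
    case (elim N)
    show ?case
    proof (intro allI impI)
      fix i s s' p \<omega> \<omega>' assume v: "variant N i s s'" and p: "p \<in> pure_strategies G i"
      from v have "i \<ge> 1" by (simp add: variant_def)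
      then show "\<bar>discounted_cost G i (x_dec G i p (y_path G N s \<omega>) \<omega>') (u_dec G i p (y_path G N s
        \<omega>) \<omega>') (y_path G N s \<omega>)
      - discounted_cost G i (x_dec G i p (y_path (freeze G i) N s' \<omega>) \<omega>')
          (u_dec G i p (y_path (freeze G i) N s' \<omega>) \<omega>') (y_path (freeze G i) N s' \<omega>)\<bar> \<le> \<eta>"
        using elim v unfolding env_close_def by (intro K(3) p) blast+
    qed
  qed
qed

subsection \<open>Measurability and independence\<close>

definition same_maps :: "('x, 'u, 'w, 'y, 'v, 'r, 'q, 'd, 'o) game_seq \<Rightarrow> bool" where
  "same_maps H \<longleftrightarrow> dyn H = dyn G \<and> env_map H = env_map G \<and> env_dyn H = env_dyn G \<and> aggr H = aggr G"

lemma same_maps: "same_maps G" "same_maps (freeze G i)"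
  by (auto simp: same_maps_def)

text \<open>The random inputs are assumed measurable one by one after composition with
  \<open>W\<close>, instead of \<open>W\<close> being measurable into the sample space. This permits
  \<open>M\<close> to be a product space or a sub-sigma-algebra that sees only some of the
  inputs.\<close>

lemma dec_measurable:
  fixes M :: "'m measure"
  assumes H: "same_maps H" and i: "i \<ge> 1"
    and S: "\<And>k. k \<in> \<T> \<Longrightarrow> (\<lambda>m. S m k) \<in> borel_measurable M"
    and X0: "(\<lambda>m. x_init H i (W m)) \<in> borel_measurable M"
    and XN: "\<And>k. k \<in> \<T> \<Longrightarrow> (\<lambda>m. x_noise H i k (W m)) \<in> borel_measurable M"
    and t: "{..<t} \<subseteq> \<T>"
    and Z: "\<And>k. k < t \<Longrightarrow> (\<lambda>m. Z m k) \<in> borel_measurable M"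
  shows "(\<lambda>m. x_dec H i (S m) (Z m) (W m) t) \<in> borel_measurable M \<and>
    (t \<in> \<T> \<longrightarrow> (\<lambda>m. u_dec H i (S m) (Z m) (W m) t) \<in> borel_measurable M)"
  using t Z
proof (induction t rule: less_induct)
  case (less t)
  have sub: "{..<k} \<subseteq> \<T>" "k \<in> \<T>" if "k < t" for k using less.prems(1) that by auto
  have IH: "(\<lambda>m. x_dec H i (S m) (Z m) (W m) k) \<in> borel_measurable M"
    "(\<lambda>m. u_dec H i (S m) (Z m) (W m) k) \<in> borel_measurable M" if "k < t" for k
    using less.IH[OF that sub(1)[OF that]] less.prems(2) sub(2)[OF that] that by auto
  have x: "(\<lambda>m. x_dec H i (S m) (Z m) (W m) t) \<in> borel_measurable M"
  proof (cases t)
    case 0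
    then show ?thesis using X0 by (simp add: x_dec.simps)
  next
    case (Suc k)
    then have k: "k < t" by simp
    have "dyn H i k \<in> borel_measurable borel"
      using A1_dyn_cont[OF i sub(2)[OF k]] H by (simp add: same_maps_def
        borel_measurable_continuous_onI)
    then show ?thesis
      unfolding Suc x_dec.simps
      by (rule measurable_compose[rotated]) (intro borel_measurable_Pair IH k less.prems(2) XN sub)
  qed
  have "(\<lambda>m. u_dec H i (S m) (Z m) (W m) t) \<in> borel_measurable M" if "t \<in> \<T>"
    unfolding u_dec.simps[of _ _ _ _ _ t]
  proof (intro borel_measurable_apply_bcontfun S that borel_measurable_Pair
    measurable_coordinatewise_then_product)
    fix k
    show "(\<lambda>m. if k \<le> t then x_dec H i (S m) (Z m) (W m) k else undefined) \<in> borel_measurable M"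
      using x IH(1)[of k] by (cases "k = t"; cases "k < t") auto
    show "(\<lambda>m. if k < t then u_dec H i (S m) (Z m) (W m) k else undefined) \<in> borel_measurable M"
      using IH(2)[of k] by (cases "k < t") auto
    show "(\<lambda>m. if k < t then Z m k else undefined) \<in> borel_measurable M"
      using less.prems(2)[of k] by (cases "k < t") auto
  qed
  with x show ?case by simp
qed

lemma aggr_measurable:
  fixes M :: "'m measure"
  assumes t: "t \<in> \<T>" and N: "N \<ge> 1"
    and X: "\<And>j. j \<in> {1..N} \<Longrightarrow> (\<lambda>m. X m j) \<in> borel_measurable M"
    and U: "\<And>j. j \<in> {1..N} \<Longrightarrow> (\<lambda>m. U m j) \<in> borel_measurable M"
  shows "(\<lambda>m. aggr G N t (\<lambda>j\<in>{1..N}. X m j) (\<lambda>j\<in>{1..N}. U m j)) \<in> borel_measurable M"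
proof -
  \<comment> \<open>(A2) speaks of extensional families only, so continuity is available on this
    subset and the composition passes through the restricted Borel space.\<close>
  define E :: "((nat \<Rightarrow> 'x) \<times> (nat \<Rightarrow> 'u)) set" where "E = extensional {1..N} \<times> extensional {1..N}"
  have "continuous_on E (\<lambda>p. aggr G N t (fst p) (snd p))"
    unfolding continuous_on_def
  proof (intro ballI tendstoI)
    fix a e assume a: "a \<in> E" and e: "(e::real) > 0"
    obtain \<delta> where \<delta>: "\<delta> > 0" "\<And>N x u x' u'. N \<ge> 1 \<Longrightarrow> x \<in> extensional {1..N} \<Longrightarrow>
      u \<in> extensional {1..N} \<Longrightarrow>
        x' \<in> extensional {1..N} \<Longrightarrow> u' \<in> extensional {1..N} \<Longrightarrow>
        (\<And>j. j \<in> {1..N} \<Longrightarrow> dist (x j, u j) (x' j, u' j) < \<delta>) \<Longrightarrow>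
        dist (aggr G N t x u) (aggr G N t x' u') < e"
      using aggr_equicontinuous[OF t e] by blast
    have "\<forall>\<^sub>F p in at a within E. dist (fst p j, snd p j) (fst a j, snd a j) < \<delta>" for j
    proof -
      have "continuous_on E (\<lambda>p. (fst p j, snd p j))"
        by (intro continuous_intros continuous_on_product_then_coordinatewise)
      then have "((\<lambda>p. (fst p j, snd p j)) \<longlongrightarrow> (fst a j, snd a j)) (at a within E)"
        using a unfolding continuous_on_def by blast
      then show ?thesis using \<delta>(1) by (rule tendstoD)
    qed
    then have "\<forall>\<^sub>F p in at a within E. \<forall>j\<in>{1..N}. dist (fst p j, snd p j) (fst a j, snd a j) < \<delta>"
      by (simp add: eventually_ball_finite)
    moreover have "\<forall>\<^sub>F p in at a within E. p \<in> E"
      by (simp add: eventually_at_filter)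
    ultimately show "\<forall>\<^sub>F p in at a within E. dist (aggr G N t (fst p) (snd p)) (aggr G N t (fst a)
      (snd a)) < e"
    proof eventually_elim
      case (elim p)
      show ?case by (rule \<delta>(2)[OF N]) (use elim a in \<open>auto simp: E_def\<close>)
    qed
  qed
  then have *: "(\<lambda>p. aggr G N t (fst p) (snd p)) \<in> borel_measurable (restrict_space borel E)"
    by (rule borel_measurable_continuous_on_restrict)
  have co: "(\<lambda>m. (\<lambda>j\<in>{1..N}. F m j) j) \<in> borel_measurable M"
    if "\<And>j. j \<in> {1..N} \<Longrightarrow> (\<lambda>m. F m j) \<in> borel_measurable M" for F :: "'m \<Rightarrow> nat \<Rightarrow>
      'z::topological_space" and j
  proof (cases "j \<in> {1..N}")
    case True
    from that[OF this] show ?thesis by (simp only: restrict_apply True if_True)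
  next
    case False
    show ?thesis by (simp only: restrict_apply False if_False borel_measurable_const)
  qed
  have "(\<lambda>m. (\<lambda>j\<in>{1..N}. X m j, \<lambda>j\<in>{1..N}. U m j)) \<in> borel_measurable M"
    by (intro borel_measurable_Pair measurable_coordinatewise_then_product co X U)
  then have "(\<lambda>m. (\<lambda>j\<in>{1..N}. X m j, \<lambda>j\<in>{1..N}. U m j)) \<in> M \<rightarrow>\<^sub>M restrict_space borel E"
    by (intro measurable_restrict_space2) (auto simp: E_def)
  from measurable_compose[OF this *] show ?thesis by simp
qed

lemma path_measurable:
  fixes M :: "'m measure"
  assumes H: "same_maps H" and N: "N \<ge> 1"
    and S: "\<And>j k. j \<in> {1..N} \<Longrightarrow> k \<in> \<T> \<Longrightarrow> (\<lambda>m. S m j k) \<in> borel_measurable M"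
    and X0: "\<And>j. j \<in> {1..N} \<Longrightarrow> (\<lambda>m. x_init H j (W m)) \<in> borel_measurable M"
    and XN: "\<And>j k. j \<in> {1..N} \<Longrightarrow> k \<in> \<T> \<Longrightarrow> (\<lambda>m. x_noise H j k (W m)) \<in> borel_measurable M"
    and E0: "(\<lambda>m. env_init H (W m)) \<in> borel_measurable M"
    and EN: "\<And>k. k \<in> \<T> \<Longrightarrow> (\<lambda>m. env_noise H k (W m)) \<in> borel_measurable M"
    and ON: "\<And>k. k \<in> \<T> \<Longrightarrow> (\<lambda>m. obs_noise H k (W m)) \<in> borel_measurable M"
    and t: "{..<t} \<subseteq> \<T>"
  shows "(\<lambda>m. env_path H N (S m) (W m) t) \<in> borel_measurable M \<and>
    (\<forall>k<t. (\<lambda>m. y_path H N (S m) (W m) k) \<in> borel_measurable M)"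
  using t
proof (induction t)
  case 0
  then show ?case using E0 by (simp add: env_path.simps)
next
  case (Suc t)
  then have t: "t \<in> \<T>" "{..<t} \<subseteq> \<T>" by auto
  from Suc.IH[OF t(2)] have IH: "(\<lambda>m. env_path H N (S m) (W m) t) \<in> borel_measurable M"
    "\<And>k. k < t \<Longrightarrow> (\<lambda>m. y_path H N (S m) (W m) k) \<in> borel_measurable M" by auto
  have "(\<lambda>m. x_path H N (S m) (W m) j t) \<in> borel_measurable M \<and>
    (\<lambda>m. u_path H N (S m) (W m) j t) \<in> borel_measurable M"
    if j: "j \<in> {1..N}" for j
  proof -
    from j have j1: "j \<ge> 1" by simp
    have "(\<lambda>m. x_dec H j (S m j) (y_path H N (S m) (W m)) (W m) t) \<in> borel_measurable M \<and>
      (t \<in> \<T> \<longrightarrow> (\<lambda>m. u_dec H j (S m j) (y_path H N (S m) (W m)) (W m) t) \<in> borel_measurable M)"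
      by (rule dec_measurable[OF H j1]) (intro S[OF j] X0[OF j] XN[OF j] IH(2) t(2); assumption)+
    then show ?thesis
      unfolding x_path_eq_dec[of H] u_path_eq_dec[of H] using t(1) by blast
  qed
  then have D: "(\<lambda>m. aggr G N t (\<lambda>j\<in>{1..N}. x_path H N (S m) (W m) j t) (\<lambda>j\<in>{1..N}. u_path H N (S
    m) (W m) j t)) \<in> borel_measurable M"
    by (intro aggr_measurable[OF t(1) N]) blast+
  have maps: "env_map G t \<in> borel_measurable borel" "env_dyn G t \<in> borel_measurable borel"
    using A1_env_map[OF t(1)] A1_env_dyn[OF t(1)] by (auto intro: borel_measurable_continuous_onI)
  have eq: "env_map H = env_map G" "env_dyn H = env_dyn G" "aggr H =
    aggr G" using H by (auto simp: same_maps_def)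
  have "(\<lambda>m. y_path H N (S m) (W m) t) \<in> borel_measurable M"
    unfolding y_path.simps[of _ _ _ _ t] eq
    by (rule measurable_compose[OF _ maps(1)]) (intro borel_measurable_Pair IH(1) D ON t(1))
  moreover have "(\<lambda>m. env_path H N (S m) (W m) (Suc t)) \<in> borel_measurable M"
    unfolding env_path.simps eq
    by (rule measurable_compose[OF _ maps(2)]) (intro borel_measurable_Pair IH(1) D EN t(1))
  ultimately show ?case using IH(2) by (auto simp: less_Suc_eq)
qed

definition dec_cost :: "nat \<Rightarrow> ('x, 'u, 'y) strategy \<Rightarrow> (nat \<Rightarrow> 'y) \<Rightarrow> 'o \<Rightarrow> real" where
  "dec_cost i s z \<omega> = discounted_cost G i (x_dec G i s z \<omega>) (u_dec G i s z \<omega>) z"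

lemma dec_cost_measurable:
  fixes M :: "'m measure"
  assumes i: "i \<ge> 1"
    and S: "\<And>k. k \<in> \<T> \<Longrightarrow> (\<lambda>m. S m k) \<in> borel_measurable M"
    and X0: "(\<lambda>m. x_init G i (W m)) \<in> borel_measurable M"
    and XN: "\<And>k. k \<in> \<T> \<Longrightarrow> (\<lambda>m. x_noise G i k (W m)) \<in> borel_measurable M"
    and Z: "\<And>k. k \<in> \<T> \<Longrightarrow> (\<lambda>m. Z m k) \<in> borel_measurable M"
  shows "(\<lambda>m. dec_cost i (S m) (Z m) (W m)) \<in> borel_measurable M"
proof -
  have dec: "(\<lambda>m. x_dec G i (S m) (Z m) (W m) t) \<in> borel_measurable M \<and>
    (t \<in> \<T> \<longrightarrow> (\<lambda>m. u_dec G i (S m) (Z m) (W m) t) \<in> borel_measurable M)" if "{..<t} \<subseteq> \<T>" for t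
    by (rule dec_measurable[OF same_maps(1) i S X0 XN that Z]) (use that in auto)
  have "(\<lambda>m. stage_term i (x_dec G i (S m) (Z m) (W m)) (u_dec G i (S m) (Z m) (W m)) (Z m) t) \<in>
    borel_measurable M" for t
  proof (cases "t \<in> \<T>")
    case True
    have c: "stage_cost G i t \<in> borel_measurable borel"
      by (rule borel_measurable_continuous_onI[OF A1_cost_cont[OF i True]])
    have "(\<lambda>m. stage_cost G i t (x_dec G i (S m) (Z m) (W m) t, u_dec G i (S m) (Z m) (W m) t,
      Z m t)) \<in> borel_measurable M"
      using dec[OF lessThan_time_set[OF True]] True Z by (intro measurable_compose[OF _ c]
        borel_measurable_Pair) auto
    then show ?thesis using True by (simp add: stage_term_def)
  qed (simp add: stage_term_def)
  moreover have "(\<lambda>m. terminal_term i (x_dec G i (S m) (Z m) (W m))) \<in> borel_measurable M"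
  proof (cases "horizon G")
    case (enat n)
    have c: "terminal_cost G i \<in> borel_measurable borel"
      by (rule borel_measurable_continuous_onI[OF A1_terminal_cont[OF i]])
    have "{..<n} \<subseteq> \<T>" using enat by (auto simp: time_set_def)
    then have "(\<lambda>m. x_dec G i (S m) (Z m) (W m) n) \<in> borel_measurable M" using dec by blast
    from measurable_compose[OF this c] show ?thesis by (simp add: terminal_term_def enat)
  qed (simp add: terminal_term_def)
  ultimately show ?thesis
    unfolding dec_cost_def discounted_cost_eq by (intro borel_measurable_add
      borel_measurable_suminf)
qed

text \<open>\<open>env_law\<close> is the law of the sequence cut off outside the time set. Costs
  read the sequence only at times in that set, and responses at time \<open>t\<close> only below
  \<open>t\<close>.\<close>

lemma dec_cost_restrict: "dec_cost i s (restrict z \<T>) \<omega> = dec_cost i s z \<omega>"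
proof -
  have eq: "x_dec G i s (restrict z \<T>) \<omega> t = x_dec G i s z \<omega> t" "u_dec G i s (restrict z \<T>) \<omega> t =
    u_dec G i s z \<omega> t"
    if "{..<t} \<subseteq> \<T>" for t
    using that by (auto intro!: dec_cong[THEN conjunct1] dec_cong[THEN conjunct2])
  have "stage_term i (x_dec G i s (restrict z \<T>) \<omega>) (u_dec G i s (restrict z \<T>) \<omega>) (restrict z \<T>)
    = stage_term i (x_dec G i s z \<omega>) (u_dec G i s z \<omega>) z"
    using eq[OF lessThan_time_set] by (auto simp: stage_term_def)
  moreover have "terminal_term i (x_dec G i s (restrict z \<T>) \<omega>) = terminal_term i (x_dec G i s z \<omega>)"
  proof (cases "horizon G")
    case (enat n)
    then have "{..<n} \<subseteq> \<T>" by (auto simp: time_set_def)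
    from eq(1)[OF this] show ?thesis by (simp add: terminal_term_def enat)
  qed (simp add: terminal_term_def)
  ultimately show ?thesis unfolding dec_cost_def discounted_cost_eq by simp
qed

lemma J_dec_eq: "J_dec G i s z = (\<integral>\<omega>. dec_cost i s z \<omega> \<partial>sample G)"
  by (simp add: J_dec_def dec_cost_def)

lemma J_game_eq: "J_game G N i s = (\<integral>\<omega>. dec_cost i (s i) (y_path G N s \<omega>) \<omega> \<partial>sample G)"
proof -
  have "x_path G N s \<omega> i = x_dec G i (s i) (y_path G N s \<omega>) \<omega>" "u_path G N s \<omega> i =
    u_dec G i (s i) (y_path G N s \<omega>) \<omega>" for \<omega>
    using path_eq_dec[of G N s \<omega> i] by auto
  then show ?thesis by (simp add: J_game_def dec_cost_def)
qed

lemma J_dec_restrict: "J_dec G i s (restrict z \<T>) = J_dec G i s z"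
  by (simp add: J_dec_eq dec_cost_restrict)

lemma prob_sample: "prob_space (sample G)"
  using setting unfolding game_setting_def by fast

lemma primitives_measurable:
  "i \<ge> 1 \<Longrightarrow> x_init G i \<in> borel_measurable (sample G)"
  "i \<ge> 1 \<Longrightarrow> t \<in> \<T> \<Longrightarrow> x_noise G i t \<in> borel_measurable (sample G)"
  "env_init G \<in> borel_measurable (sample G)"
  "t \<in> \<T> \<Longrightarrow> env_noise G t \<in> borel_measurable (sample G)"
  "t \<in> \<T> \<Longrightarrow> obs_noise G t \<in> borel_measurable (sample G)"
  using setting unfolding game_setting_def by (elim conjE; fast)+

section \<open>Independence of the primitives of \<open>i\<close> from all the others\<close>

definition events_of :: "nat \<Rightarrow> 'o set set" where
  "events_of i = (if i = 0 then {omega0 G -` A \<inter> space (sample G) | A. A \<in> sets borel}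
            else {omega G i -` A \<inter> space (sample G) | A. A \<in> sets borel})"

text \<open>Serves only as a measurable space: the sub-sigma-algebra generated by the primitives
  with index in \<open>I\<close>, where index 0 is the environment.\<close>

definition sigma_of :: "nat set \<Rightarrow> 'o measure" where
  "sigma_of I = sigma (space (sample G)) (\<Union>i\<in>I. events_of i)"

lemma events_of_subset: "(\<Union>i\<in>I. events_of i) \<subseteq> Pow (space (sample G))"
  by (auto simp: events_of_def)

lemma space_sigma_of [simp]: "space (sigma_of I) = space (sample G)"
  by (simp add: sigma_of_def events_of_subset)

lemma sets_sigma_of: "sets (sigma_of I) = sigma_sets (space (sample G)) (\<Union>i\<in>I. events_of i)"
  by (simp add: sigma_of_def events_of_subset)

lemma sigma_of_measurable:
  assumes "i \<in> I"
  shows "i = 0 \<Longrightarrow> omega0 G \<in> borel_measurable (sigma_of I)"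
    and "i > 0 \<Longrightarrow> omega G i \<in> borel_measurable (sigma_of I)"
  using assms by (auto simp: measurable_def sets_sigma_of events_of_def intro!: sigma_sets.Basic)

lemma omega_component_measurable:
  assumes "omega G i \<in> borel_measurable M"
  shows "x_init G i \<in> borel_measurable M" "t \<in> \<T> \<Longrightarrow> x_noise G i t \<in> borel_measurable M"
proof -
  have "fst \<in> borel_measurable (borel :: ('x \<times> (nat \<Rightarrow> 'w)) measure)"
    "(\<lambda>p. snd p t) \<in> borel_measurable (borel :: ('x \<times> (nat \<Rightarrow> 'w)) measure)"
    by (intro borel_measurable_continuous_onI continuous_intros
      continuous_on_product_then_coordinatewise)+
  from this[THEN measurable_compose[OF assms]]
  show "x_init G i \<in> borel_measurable M" "t \<in> \<T> \<Longrightarrow> x_noise G i t \<in> borel_measurable M"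
    by (auto simp: omega_def)
qed

lemma omega0_component_measurable:
  assumes "omega0 G \<in> borel_measurable M"
  shows "env_init G \<in> borel_measurable M" "t \<in> \<T> \<Longrightarrow> env_noise G t \<in> borel_measurable M"
    "t \<in> \<T> \<Longrightarrow> obs_noise G t \<in> borel_measurable M"
proof -
  have "fst \<in> borel_measurable (borel :: ('v \<times> (nat \<Rightarrow> 'r) \<times> (nat \<Rightarrow> 'q)) measure)"
    "(\<lambda>p. fst (snd p) t) \<in> borel_measurable (borel :: ('v \<times> (nat \<Rightarrow> 'r) \<times> (nat \<Rightarrow> 'q)) measure)"
    "(\<lambda>p. snd (snd p) t) \<in> borel_measurable (borel :: ('v \<times> (nat \<Rightarrow> 'r) \<times> (nat \<Rightarrow> 'q)) measure)"
    by (intro borel_measurable_continuous_onI continuous_intros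
      continuous_on_product_then_coordinatewise)+
  from this[THEN measurable_compose[OF assms]]
  show "env_init G \<in> borel_measurable M" "t \<in> \<T> \<Longrightarrow> env_noise G t \<in> borel_measurable M"
    "t \<in> \<T> \<Longrightarrow> obs_noise G t \<in> borel_measurable M"
    by (auto simp: omega0_def)
qed

lemma Int_stable_events_of: "Int_stable (events_of i)"
proof -
  have st: "Int_stable {f -` A \<inter> X | A. A \<in> sets borel}" for f :: "'o \<Rightarrow> 'b::topological_space" and X
  proof (rule Int_stableI)
    fix a b assume "a \<in> {f -` A \<inter> X | A. A \<in> sets borel}" "b \<in> {f -` A \<inter> X | A. A \<in> sets borel}"
    then obtain A B where "A \<in> sets borel" "B \<in> sets borel" "a = f -` A \<inter> X" "b =
      f -` B \<inter> X" by blast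
    then show "a \<inter> b \<in> {f -` A \<inter> X | A. A \<in> sets borel}"
      by (intro CollectI exI[of _ "A \<inter> B"]) auto
  qed
  show ?thesis by (cases "i = 0") (simp_all add: events_of_def st)
qed

text \<open>The identity, viewed as a map into two coarser sigma-algebras, gives two independent
  random variables. Hence the diagonal map carries the sample measure to the product of the two
  restrictions, and Fubini applies.\<close>

lemma independent_integral:
  fixes h :: "'o \<times> 'o \<Rightarrow> real"
  assumes h: "h \<in> borel_measurable (sigma_of (- {i}) \<Otimes>\<^sub>M sigma_of {i})" and B: "\<And>p. \<bar>h p\<bar> \<le> B"
  shows "(\<integral>\<omega>. h (\<omega>, \<omega>) \<partial>sample G) = (\<integral>\<omega>. \<integral>\<omega>'. h (\<omega>, \<omega>') \<partial>sample G \<partial>sample G)"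
proof -
  interpret prob_space "sample G" by (rule prob_sample)
  let ?S = "sample G" and ?A = "sigma_of (- {i})" and ?B = "sigma_of {i}"
  \<comment> \<open>Mutual independence is grouped into two blocks, everything except
    \<open>i\<close> and \<open>i\<close> alone; the blocks exhaust all indices.\<close>
  let ?I = "case_bool (- {i}) {i}"
  have "indep_sets (\<lambda>b. sigma_sets (space ?S) (\<Union>j\<in>?I b. events_of j)) UNIV"
  proof (rule indep_sets_collect_sigma)
    have "(\<Union>b. ?I b) = UNIV" by (auto simp: UNIV_bool)
    then show "indep_sets events_of (\<Union>b. ?I b)"
      using A3 unfolding condition_A3_def events_of_def by simp
  qed (auto simp: Int_stable_events_of disjoint_family_on_def split: bool.splits)
  also have "(\<lambda>b. sigma_sets (space ?S) (\<Union>j\<in>?I b. events_of j)) = case_bool (sets ?A) (sets ?B)"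
    by (rule ext) (simp add: sets_sigma_of split: bool.split)
  finally have ind: "indep_set (sets ?A) (sets ?B)" unfolding indep_set_def .
  have rv: "(\<lambda>x. x) \<in> ?S \<rightarrow>\<^sub>M ?A" "(\<lambda>x. x) \<in> ?S \<rightarrow>\<^sub>M ?B"
    using indep_setD_ev1[OF ind] indep_setD_ev2[OF ind] sets.sets_into_space
    by (auto simp: measurable_def Int_absorb2)
  have "{(\<lambda>x. x) -` X \<inter> space ?S | X. X \<in> sets (sigma_of I)} = sets (sigma_of I)" for I
    using sets.sets_into_space[of _ "sigma_of I"] by (auto simp: Int_absorb2)
  then have "indep_var ?A (\<lambda>x. x) ?B (\<lambda>x. x)"
    unfolding indep_var_eq using rv ind sets.sigma_sets_eq[of "sigma_of I" for I] by simp
  then have eq: "distr ?S ?A (\<lambda>x. x) \<Otimes>\<^sub>M distr ?S ?B (\<lambda>x. x) = distr ?S (?A \<Otimes>\<^sub>M ?B) (\<lambda>x. (x, x))"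
    unfolding indep_var_distribution_eq by blast
  interpret DA: prob_space "distr ?S ?A (\<lambda>x. x)" by (rule prob_space_distr[OF rv(1)])
  interpret DB: prob_space "distr ?S ?B (\<lambda>x. x)" by (rule prob_space_distr[OF rv(2)])
  interpret D: pair_prob_space "distr ?S ?A (\<lambda>x. x)" "distr ?S ?B (\<lambda>x. x)" ..
  have hD: "h \<in> borel_measurable (distr ?S ?A (\<lambda>x. x) \<Otimes>\<^sub>M distr ?S ?B (\<lambda>x. x))"
    using h by (simp cong: measurable_cong_sets sets_pair_measure_cong)
  have hI: "integrable (distr ?S ?A (\<lambda>x. x) \<Otimes>\<^sub>M distr ?S ?B (\<lambda>x. x)) h"
    by (rule D.integrable_const_bound[of _ B]) (use hD B in simp_all)
  have "(\<integral>\<omega>. h (\<omega>, \<omega>) \<partial>?S) = integral\<^sup>L (distr ?S (?A \<Otimes>\<^sub>M ?B) (\<lambda>x. (x, x))) h"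
    by (rule integral_distr[symmetric, OF measurable_Pair[OF rv] h])
  also have "\<dots> = integral\<^sup>L (distr ?S ?A (\<lambda>x. x) \<Otimes>\<^sub>M distr ?S ?B (\<lambda>x. x)) h" by (simp add: eq)
  also have "\<dots> = (\<integral>\<omega>. \<integral>\<omega>'. h (\<omega>, \<omega>') \<partial>distr ?S ?B (\<lambda>x. x) \<partial>distr ?S ?A (\<lambda>x. x))"
    by (rule D.integral_fst'[symmetric, OF hI])
  also have "\<dots> = (\<integral>\<omega>. \<integral>\<omega>'. h (\<omega>, \<omega>') \<partial>distr ?S ?B (\<lambda>x. x) \<partial>?S)"
  proof (rule integral_distr[OF rv(1)])
    show "(\<lambda>\<omega>. \<integral>\<omega>'. h (\<omega>, \<omega>') \<partial>distr ?S ?B (\<lambda>x. x)) \<in> borel_measurable ?A"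
      by (rule DB.borel_measurable_lebesgue_integral)
        (use h in \<open>simp add: case_prod_eta cong: measurable_cong_sets sets_pair_measure_cong\<close>)
  qed
  also have "\<dots> = (\<integral>\<omega>. \<integral>\<omega>'. h (\<omega>, \<omega>') \<partial>?S \<partial>?S)"
  proof (rule Bochner_Integration.integral_cong[OF refl])
    \<comment> \<open>Sections of \<open>h\<close> are measurable for the coarser sigma-algebra, so
      integrating over the restricted measure or over the full one gives the same value.\<close>
    fix \<omega> assume \<omega>: "\<omega> \<in> space ?S"
    have "(\<lambda>\<omega>'. (\<omega>, \<omega>')) \<in> ?B \<rightarrow>\<^sub>M ?A \<Otimes>\<^sub>M ?B" using \<omega> by (intro measurable_Pair1') simp
    then have "(\<lambda>\<omega>'. h (\<omega>, \<omega>')) \<in> borel_measurable ?B" by (rule measurable_compose[OF _ h])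
    then show "(\<integral>\<omega>'. h (\<omega>, \<omega>') \<partial>distr ?S ?B (\<lambda>x. x)) = (\<integral>\<omega>'. h (\<omega>, \<omega>') \<partial>?S)"
      by (rule integral_distr[OF rv(2)])
  qed
  finally show ?thesis .
qed

subsection \<open>Comparison of the two expected costs\<close>

lemma J_dec_measurable:
  fixes M :: "'m measure"
  assumes i: "i \<ge> 1"
    and S: "\<And>k. k \<in> \<T> \<Longrightarrow> (\<lambda>m. S m k) \<in> borel_measurable M"
    and Z: "\<And>k. k \<in> \<T> \<Longrightarrow> (\<lambda>m. Z m k) \<in> borel_measurable M"
  shows "(\<lambda>m. J_dec G i (S m) (Z m)) \<in> borel_measurable M"
proof -
  interpret prob_space "sample G" by (rule prob_sample)
  have "(\<lambda>q. dec_cost i (S (fst q)) (Z (fst q)) (snd q)) \<in> borel_measurable (M \<Otimes>\<^sub>M sample G)"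
    by (intro dec_cost_measurable[OF i] measurable_compose[OF measurable_fst]
      measurable_compose[OF measurable_snd]
        S Z primitives_measurable(1,2)[OF i])
  then show ?thesis
    unfolding J_dec_eq by (intro borel_measurable_lebesgue_integral) (simp add: case_prod_beta')
qed

lemma mixed_prob: "\<mu> \<in> mixed_strategies G i \<Longrightarrow> prob_space \<mu>"
  and mixed_sets: "\<mu> \<in> mixed_strategies G i \<Longrightarrow> sets \<mu> = sets (restrict_space borel (pure_strategies
    G i))"
  by (auto simp: mixed_strategies_def prob_measures_on_def)

lemma mixed_space: "\<mu> \<in> mixed_strategies G i \<Longrightarrow> space \<mu> = pure_strategies G i"
  using sets_eq_imp_space_eq[OF mixed_sets] by (simp add: space_restrict_space)

lemma mixed_coordinate:
  assumes "\<mu> \<in> mixed_strategies G i"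
  shows "(\<lambda>s. s k) \<in> borel_measurable \<mu>"
  unfolding measurable_cong_sets[OF mixed_sets[OF assms] refl]
  by (intro measurable_restrict_space1 measurable_product_coordinates)

section \<open>One decision maker \<open>i\<close> using \<open>\<mu>\<close> against the others'
  \<open>\<gamma>\<close>, for equilibrium and deviation alike\<close>

context
  fixes N i :: nat and \<gamma> :: "nat \<Rightarrow> ('x, 'u, 'y) strategy measure" and \<mu> :: "('x, 'u,
    'y) strategy measure"
    and \<eta> B :: real
  assumes \<gamma>: "\<And>j. j \<in> {1..N} \<Longrightarrow> \<gamma> j \<in> mixed_strategies G j" and i: "i \<in> {1..N}"
    and \<mu>: "\<mu> \<in> mixed_strategies G i"
    and B: "\<And>x u y. \<bar>discounted_cost G i x u y\<bar> \<le> B"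
    and close: "\<And>s s' p \<omega> \<omega>'. variant N i s s' \<Longrightarrow> p \<in> pure_strategies G i \<Longrightarrow>
      \<bar>dec_cost i p (y_path G N s \<omega>) \<omega>' - dec_cost i p (y_path (freeze G i) N s' \<omega>) \<omega>'\<bar> \<le> \<eta>"
begin

text \<open>Overwriting coordinate \<open>i\<close> makes the sequence literally independent of
  \<open>s i\<close>, which later allows coordinate \<open>i\<close> to be integrated
  separately.\<close>

definition y_ref :: "(nat \<Rightarrow> ('x, 'u, 'y) strategy) \<Rightarrow> 'o \<Rightarrow> nat \<Rightarrow> 'y" where
  "y_ref s \<omega> = y_path (freeze G i) N (s(i := undefined)) \<omega>"

definition K_ref :: "('x, 'u, 'y) strategy \<Rightarrow> (nat \<Rightarrow> ('x, 'u, 'y) strategy) \<Rightarrow> real" where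
  "K_ref p s = (\<integral>\<omega>. J_dec G i p (y_ref s \<omega>) \<partial>sample G)"

lemma i1: "i \<ge> 1" and N1: "N \<ge> 1" using i by auto

lemma y_ref_upd: "y_ref (s(i := p)) = y_ref s"
  by (simp add: y_ref_def[abs_def])

lemma K_ref_upd: "K_ref p (s(i := p')) = K_ref p s"
  by (simp add: K_ref_def y_ref_upd)

lemma dec_cost_bound: "\<bar>dec_cost i p z \<omega>\<bar> \<le> B"
  by (simp add: dec_cost_def B)

lemma J_dec_bound: "\<bar>J_dec G i p z\<bar> \<le> B"
  unfolding J_dec_eq by (rule prob_space.integral_abs_le[OF prob_sample dec_cost_bound])

lemma K_ref_bound: "\<bar>K_ref p s\<bar> \<le> B"
  unfolding K_ref_def by (rule prob_space.integral_abs_le[OF prob_sample J_dec_bound])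

lemma dec_cost_fixed_measurable: "dec_cost i p z \<in> borel_measurable (sample G)"
  by (intro dec_cost_measurable[OF i1] borel_measurable_const primitives_measurable i1)

lemma admissible_close:
  assumes "\<And>j. j \<in> {1..N} \<Longrightarrow> s j \<in> pure_strategies G j" "p \<in> pure_strategies G i"
  shows "\<bar>dec_cost i p (y_path G N s \<omega>) \<omega>' - dec_cost i p (y_ref s \<omega>) \<omega>'\<bar> \<le> \<eta>"
  unfolding y_ref_def by (rule close) (use assms i in \<open>auto simp: variant_def\<close>)

lemma y_measurable:
  fixes M :: "'m measure"
  assumes S: "\<And>j k. j \<in> {1..N} \<Longrightarrow> k \<in> \<T> \<Longrightarrow> (\<lambda>m. S m j k) \<in> borel_measurable M"
    and W: "W \<in> M \<rightarrow>\<^sub>M sample G" and k: "k \<in> \<T>"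
  shows "(\<lambda>m. y_path G N (S m) (W m) k) \<in> borel_measurable M"
proof -
  have "{..<Suc k} \<subseteq> \<T>" using k lessThan_time_set[OF k] by (simp add: lessThan_Suc)
  then have "\<forall>l<Suc k. (\<lambda>m. y_path G N (S m) (W m) l) \<in> borel_measurable M"
    using primitives_measurable[THEN measurable_compose[OF W]] S
    by (intro path_measurable[THEN conjunct2, OF same_maps(1) N1]) auto
  then show ?thesis by blast
qed

text \<open>No primitive of \<open>i\<close> occurs in the hypotheses, so \<open>M\<close> can be
  \<open>sigma_of (- {i})\<close>; this is how independence of the noise of \<open>i\<close> is
  expressed.\<close>

lemma y_ref_measurable:
  fixes M :: "'m measure"
  assumes S: "\<And>j k. j \<in> {1..N} - {i} \<Longrightarrow> k \<in> \<T> \<Longrightarrow> (\<lambda>m. S m j k) \<in> borel_measurable M"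
    and X0: "\<And>j. j \<in> {1..N} - {i} \<Longrightarrow> (\<lambda>m. x_init G j (W m)) \<in> borel_measurable M"
    and XN: "\<And>j k. j \<in> {1..N} - {i} \<Longrightarrow> k \<in> \<T> \<Longrightarrow> (\<lambda>m. x_noise G j k (W m)) \<in> borel_measurable M"
    and E0: "(\<lambda>m. env_init G (W m)) \<in> borel_measurable M"
    and EN: "\<And>k. k \<in> \<T> \<Longrightarrow> (\<lambda>m. env_noise G k (W m)) \<in> borel_measurable M"
    and ON: "\<And>k. k \<in> \<T> \<Longrightarrow> (\<lambda>m. obs_noise G k (W m)) \<in> borel_measurable M"
    and k: "k \<in> \<T>"
  shows "(\<lambda>m. y_ref (S m) (W m) k) \<in> borel_measurable M"
proof -
  have "{..<Suc k} \<subseteq> \<T>" using k lessThan_time_set[OF k] by (simp add: lessThan_Suc)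
  have "\<forall>l<Suc k. (\<lambda>m. y_path (freeze G i) N ((S m)(i := undefined)) (W m) l) \<in> borel_measurable M"
  proof (rule path_measurable[THEN conjunct2, OF same_maps(2) N1])
    fix j l assume "j \<in> {1..N}" "l \<in> \<T>"
    then show "(\<lambda>m. ((S m)(i := undefined)) j l) \<in> borel_measurable M"
      "(\<lambda>m. x_noise (freeze G i) j l (W m)) \<in> borel_measurable M"
      using S[of j l] XN[of j l] by (cases "j = i"; simp)+
  next
    fix j assume "j \<in> {1..N}"
    then show "(\<lambda>m. x_init (freeze G i) j (W m)) \<in> borel_measurable M"
      using X0[of j] by (cases "j = i") simp_all
  qed (use E0 EN ON \<open>{..<Suc k} \<subseteq> \<T>\<close> in simp_all)
  then show ?thesis by (simp add: y_ref_def)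
qed

lemma y_ref_measurable':
  fixes M :: "'m measure"
  assumes S: "\<And>j k. j \<in> {1..N} \<Longrightarrow> k \<in> \<T> \<Longrightarrow> (\<lambda>m. S m j k) \<in> borel_measurable M"
    and W: "W \<in> M \<rightarrow>\<^sub>M sample G" and k: "k \<in> \<T>"
  shows "(\<lambda>m. y_ref (S m) (W m) k) \<in> borel_measurable M"
  using primitives_measurable[THEN measurable_compose[OF W]] S k
  by (intro y_ref_measurable) auto

lemma K_ref_measurable:
  fixes M :: "'m measure"
  assumes P: "\<And>k. k \<in> \<T> \<Longrightarrow> (\<lambda>m. p m k) \<in> borel_measurable M"
    and S: "\<And>j k. j \<in> {1..N} \<Longrightarrow> k \<in> \<T> \<Longrightarrow> (\<lambda>m. S m j k) \<in> borel_measurable M"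
  shows "(\<lambda>m. K_ref (p m) (S m)) \<in> borel_measurable M"
proof -
  interpret prob_space "sample G" by (rule prob_sample)
  have "(\<lambda>a. J_dec G i (p (fst a)) (y_ref (S (fst a)) (snd a))) \<in> borel_measurable (M \<Otimes>\<^sub>M sample G)"
    by (intro J_dec_measurable[OF i1] y_ref_measurable' measurable_compose[OF measurable_fst] P S
      measurable_snd)
  then show ?thesis
    unfolding K_ref_def by (intro borel_measurable_lebesgue_integral) (simp add: case_prod_beta')
qed

text \<open>The only use of (A3): the reference environment is a function of \<open>\<omega>\<^sup>j\<close>, \<open>j \<noteq> i\<close>, and the
  response of decision maker \<open>i\<close> to a fixed environment is a function of \<open>\<omega>\<^sup>i\<close>.\<close>

lemma decoupling: "(\<integral>\<omega>. dec_cost i p (y_ref s \<omega>) \<omega> \<partial>sample G) = K_ref p s"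
proof -
  have "(\<lambda>a. dec_cost i p (y_ref s (fst a)) (snd a)) \<in> borel_measurable (sigma_of (-
    {i}) \<Otimes>\<^sub>M sigma_of {i})"
  proof (intro dec_cost_measurable[OF i1] measurable_compose[OF measurable_snd]
    measurable_compose[OF measurable_fst])
    have "omega G i \<in> borel_measurable (sigma_of {i})" by (rule sigma_of_measurable) (use i1 in
      auto)
    from omega_component_measurable[OF this]
    show "x_init G i \<in> borel_measurable (sigma_of {i})"
      "\<And>k. k \<in> \<T> \<Longrightarrow> x_noise G i k \<in> borel_measurable (sigma_of {i})" by auto
  next
    fix k assume k: "k \<in> \<T>"
    have o: "omega G j \<in> borel_measurable (sigma_of (- {i}))" if "j \<in> {1..N} - {i}" for j
      by (rule sigma_of_measurable) (use that in auto)
    have o0: "omega0 G \<in> borel_measurable (sigma_of (- {i}))" by (rule sigma_of_measurable) (use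
      i1 in auto)
    show "(\<lambda>\<omega>. y_ref s \<omega> k) \<in> borel_measurable (sigma_of (- {i}))"
      by (intro y_ref_measurable k borel_measurable_const omega_component_measurable[OF o]
          omega0_component_measurable[OF o0])
  qed auto
  from independent_integral[OF this, of B] show ?thesis
    by (simp add: dec_cost_bound K_ref_def J_dec_eq)
qed

lemma profile_coordinate:
  assumes "\<And>j. j \<in> {1..N} \<Longrightarrow> \<alpha> j \<in> mixed_strategies G j" "j \<in> {1..N}"
  shows "(\<lambda>s. s j k) \<in> borel_measurable (Pi\<^sub>M {1..N} \<alpha>)"
  by (rule measurable_compose[where g = "\<lambda>s. s k", OF measurable_component_singleton[where M = \<alpha>,
    OF assms(2)] mixed_coordinate[OF assms(1)[OF assms(2)]]])

lemma profile_space: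
  assumes "\<And>j. j \<in> {1..N} \<Longrightarrow> \<alpha> j \<in> mixed_strategies G j" "s \<in> space (Pi\<^sub>M {1..N} \<alpha>)" "j \<in> {1..N}"
  shows "s j \<in> pure_strategies G j"
  using assms(2,3) mixed_space[OF assms(1)[OF assms(3)]] by (auto simp: space_PiM dest: PiE_mem)

lemma profile_prob:
  assumes "\<And>j. j \<in> {1..N} \<Longrightarrow> \<alpha> j \<in> mixed_strategies G j"
  shows "prob_space (Pi\<^sub>M {1..N} \<alpha>)"
  using mixed_prob[OF assms] by (intro prob_space_PiM)

lemma deviation: "j \<in> {1..N} \<Longrightarrow> (\<gamma>(i := \<mu>)) j \<in> mixed_strategies G j"
  using \<gamma> \<mu> by simp

lemma game_K_ref: "\<bar>expected_J_game G N i (\<gamma>(i := \<mu>)) - (\<integral>s. K_ref (s i) s \<partial>(Pi\<^sub>M {1..N} (\<gamma>(i :=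
  \<mu>))))\<bar> \<le> \<eta>"
proof -
  interpret S: prob_space "sample G" by (rule prob_sample)
  let ?P = "Pi\<^sub>M {1..N} (\<gamma>(i := \<mu>))"
  interpret P: prob_space ?P by (rule profile_prob[OF deviation])
  note coord = profile_coordinate[OF deviation]
  show ?thesis
    unfolding expected_J_game_def
  proof (rule P.integral_close)
    have "(\<lambda>a. dec_cost i (fst a i) (y_path G N (fst a) (snd a)) (snd a)) \<in> borel_measurable (?P
      \<Otimes>\<^sub>M sample G)"
      by (intro dec_cost_measurable[OF i1] y_measurable measurable_compose[OF measurable_fst coord]
        measurable_snd i measurable_compose[OF measurable_snd] primitives_measurable(1,2)[OF i1])
    then show "J_game G N i \<in> borel_measurable ?P"
      unfolding J_game_eq[abs_def] by (intro S.borel_measurable_lebesgue_integral) (simp add: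
        case_prod_beta')
    show "(\<lambda>s. K_ref (s i) s) \<in> borel_measurable ?P"
      by (intro K_ref_measurable coord i)
  next
    fix s
    show "\<bar>J_game G N i s\<bar> \<le> B" unfolding J_game_eq by (rule S.integral_abs_le[OF dec_cost_bound])
    show "\<bar>K_ref (s i) s\<bar> \<le> B" by (rule K_ref_bound)
    assume s: "s \<in> space ?P"
    show "\<bar>J_game G N i s - K_ref (s i) s\<bar> \<le> \<eta>"
      unfolding decoupling[symmetric] J_game_eq
    proof (rule S.integral_close[OF _ _ dec_cost_bound dec_cost_bound])
      show "\<bar>dec_cost i (s i) (y_path G N s \<omega>) \<omega> - dec_cost i (s i) (y_ref s \<omega>) \<omega>\<bar> \<le> \<eta>" for \<omega>
        using profile_space[OF deviation s] i by (intro admissible_close)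
      show "(\<lambda>\<omega>. dec_cost i (s i) (y_path G N s \<omega>) \<omega>) \<in> borel_measurable (sample G)"
        by (intro dec_cost_measurable[OF i1] y_measurable borel_measurable_const
          primitives_measurable i1 measurable_ident_sets[OF refl])
      show "(\<lambda>\<omega>. dec_cost i (s i) (y_ref s \<omega>) \<omega>) \<in> borel_measurable (sample G)"
        by (intro dec_cost_measurable[OF i1] y_ref_measurable' borel_measurable_const
          primitives_measurable i1 measurable_ident_sets[OF refl])
    qed
  qed
qed

text \<open>\<open>K_ref\<close> sees \<open>s i\<close> only as the responding strategy. Fubini
  splits off coordinate \<open>i\<close>, distributed by \<open>\<mu>\<close>; reinserting a
  coordinate distributed by \<open>\<gamma> i\<close> changes nothing, since the remaining integrand
  ignores it.\<close>

lemma K_ref_swap: "(\<integral>s. K_ref (s i) s \<partial>(Pi\<^sub>M {1..N} (\<gamma>(i := \<mu>)))) =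
  (\<integral>s. (\<integral>p. K_ref p s \<partial>\<mu>) \<partial>(Pi\<^sub>M {1..N} \<gamma>))"
proof -
  define I where "I = {1..N} - {i}"
  have I: "{1..N} = insert i I" "finite I" "i \<notin> I" using i by (auto simp: I_def)
  \<comment> \<open>\<open>product_prob_space\<close> asks for a probability measure at every index,
    so indices outside the game receive \<open>\<mu>\<close>.\<close>
  define \<gamma>0 where "\<gamma>0 j = (if j \<in> {1..N} then \<gamma> j else \<mu>)" for j
  have pr: "prob_space (\<gamma>0 j)" "prob_space ((\<gamma>0(i := \<mu>)) j)" for j
    using mixed_prob[OF \<gamma>] mixed_prob[OF \<mu>] by (auto simp: \<gamma>0_def)
  interpret \<mu>: prob_space \<mu> by (rule mixed_prob[OF \<mu>])
  interpret A: product_prob_space \<gamma>0 by (rule product_prob_spaceI) (rule pr)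
  interpret A': product_prob_space "\<gamma>0(i := \<mu>)" by (rule product_prob_spaceI) (rule pr)
  have eq: "Pi\<^sub>M {1..N} \<gamma> = Pi\<^sub>M (insert i I) \<gamma>0" "Pi\<^sub>M {1..N} (\<gamma>(i := \<mu>)) =
    Pi\<^sub>M (insert i I) (\<gamma>0(i := \<mu>))"
    "Pi\<^sub>M I (\<gamma>0(i := \<mu>)) = Pi\<^sub>M I \<gamma>0"
    using I by (auto intro!: PiM_cong simp: \<gamma>0_def)
  interpret P: prob_space "Pi\<^sub>M {1..N} \<gamma>" by (rule profile_prob[OF \<gamma>])
  interpret P': prob_space "Pi\<^sub>M {1..N} (\<gamma>(i := \<mu>))" by (rule profile_prob[OF deviation])
  have m: "(\<lambda>s. K_ref (s i) s) \<in> borel_measurable (Pi\<^sub>M {1..N} (\<gamma>(i := \<mu>)))"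
    by (intro K_ref_measurable profile_coordinate[OF deviation] i)
  have "(\<lambda>a. K_ref (snd a) (fst a)) \<in> borel_measurable (Pi\<^sub>M {1..N} \<gamma> \<Otimes>\<^sub>M \<mu>)"
    by (intro K_ref_measurable measurable_compose[OF measurable_fst] measurable_compose[OF
      measurable_snd]
      profile_coordinate[OF \<gamma>] mixed_coordinate[OF \<mu>])
  then have m': "(\<lambda>s. \<integral>p. K_ref p s \<partial>\<mu>) \<in> borel_measurable (Pi\<^sub>M {1..N} \<gamma>)"
    by (intro \<mu>.borel_measurable_lebesgue_integral) (simp add: case_prod_beta')
  have int: "integrable (Pi\<^sub>M {1..N} (\<gamma>(i := \<mu>))) (\<lambda>s. K_ref (s i) s)"
    by (rule P'.integrable_const_bound[of _ B]) (use m K_ref_bound in simp_all)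
  have int': "integrable (Pi\<^sub>M {1..N} \<gamma>) (\<lambda>s. \<integral>p. K_ref p s \<partial>\<mu>)"
    by (rule P.integrable_const_bound[of _ B]) (use m' \<mu>.integral_abs_le[OF K_ref_bound] in
      simp_all)
  have "(\<integral>s. K_ref (s i) s \<partial>(Pi\<^sub>M {1..N} (\<gamma>(i := \<mu>)))) = (\<integral>s. (\<integral>p. K_ref p s \<partial>\<mu>) \<partial>(Pi\<^sub>M I \<gamma>0))"
    unfolding eq(2) using A'.product_integral_insert[OF I(2,3) int[unfolded eq(2)]]
    by (simp add: K_ref_upd eq(3))
  also have "\<dots> = (\<integral>s. (\<integral>p. K_ref p s \<partial>\<mu>) \<partial>(Pi\<^sub>M {1..N} \<gamma>))"
    unfolding eq(1) using A.product_integral_insert[OF I(2,3) int'[unfolded eq(1)]]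
    by (simp add: K_ref_upd prob_space.prob_space[OF pr(1)])
  finally show ?thesis .
qed

lemma K_ref_env_law: "\<bar>(\<integral>s. (\<integral>p. K_ref p s \<partial>\<mu>) \<partial>(Pi\<^sub>M {1..N} \<gamma>)) -
  expected_J_dec G i \<mu> (env_law G N \<gamma>)\<bar> \<le> \<eta>"
proof -
  let ?P = "Pi\<^sub>M {1..N} \<gamma>" and ?S = "sample G"
  interpret S: prob_space ?S by (rule prob_sample)
  interpret P: prob_space ?P by (rule profile_prob[OF \<gamma>])
  interpret \<mu>: prob_space \<mu> by (rule mixed_prob[OF \<mu>])
  interpret PS: pair_prob_space ?P ?S ..
  interpret \<mu>S: pair_prob_space \<mu> ?S ..
  note coord = profile_coordinate[OF \<gamma>] and strat = mixed_coordinate[OF \<mu>]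
  define R where "R z = (\<integral>p. J_dec G i p z \<partial>\<mu>)" for z
  have R_bound: "\<bar>R z\<bar> \<le> B" for z unfolding R_def by (rule \<mu>.integral_abs_le[OF J_dec_bound])
  have R_meas: "(\<lambda>m. R (Z m)) \<in> borel_measurable M"
    if Z: "\<And>k. k \<in> \<T> \<Longrightarrow> (\<lambda>m. Z m k) \<in> borel_measurable M" for M :: "'m measure" and Z
  proof -
    have "(\<lambda>a. J_dec G i (snd a) (Z (fst a))) \<in> borel_measurable (M \<Otimes>\<^sub>M \<mu>)"
      by (intro J_dec_measurable[OF i1] measurable_compose[OF measurable_fst]
        measurable_compose[OF measurable_snd] Z strat)
    then show ?thesis
      unfolding R_def by (intro \<mu>.borel_measurable_lebesgue_integral) (simp add: case_prod_beta')
  qed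
  have y: "(\<lambda>a. y_path G N (fst a) (snd a) k) \<in> borel_measurable (?P \<Otimes>\<^sub>M ?S)" if "k \<in> \<T>" for k
    by (intro y_measurable measurable_compose[OF measurable_fst coord] measurable_snd that)
  have y': "(\<lambda>a. y_ref (fst a) (snd a) k) \<in> borel_measurable (?P \<Otimes>\<^sub>M ?S)" if "k \<in> \<T>" for k
    by (intro y_ref_measurable' measurable_compose[OF measurable_fst coord] measurable_snd that)
  have Ry: "(\<lambda>a. R (y_path G N (fst a) (snd a))) \<in> borel_measurable (?P \<Otimes>\<^sub>M ?S)"
    "(\<lambda>a. R (y_ref (fst a) (snd a))) \<in> borel_measurable (?P \<Otimes>\<^sub>M ?S)"
    using y y' by (auto intro: R_meas)
  have "(\<integral>p. K_ref p s \<partial>\<mu>) = (\<integral>\<omega>. R (y_ref s \<omega>) \<partial>?S)" for s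
  proof -
    have "(\<lambda>a. J_dec G i (fst a) (y_ref s (snd a))) \<in> borel_measurable (\<mu> \<Otimes>\<^sub>M ?S)"
      by (intro J_dec_measurable[OF i1] y_ref_measurable' measurable_compose[OF measurable_fst
        strat]
          borel_measurable_const measurable_snd)
    then have "integrable (\<mu> \<Otimes>\<^sub>M ?S) (\<lambda>a. J_dec G i (fst a) (y_ref s (snd a)))"
      by (intro \<mu>S.integrable_const_bound[of _ B]) (simp_all add: J_dec_bound)
    then show ?thesis
      unfolding K_ref_def R_def
      by (intro \<mu>S.Fubini_integral[symmetric]) (simp add: case_prod_beta')
  qed
  then have "(\<integral>s. (\<integral>p. K_ref p s \<partial>\<mu>) \<partial>?P) = (\<integral>s. (\<integral>\<omega>. R (y_ref s \<omega>) \<partial>?S) \<partial>?P)" by simp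
  also have "\<dots> = (\<integral>a. R (y_ref (fst a) (snd a)) \<partial>(?P \<Otimes>\<^sub>M ?S))"
  proof -
    have "integrable (?P \<Otimes>\<^sub>M ?S) (\<lambda>a. R (y_ref (fst a) (snd a)))"
      by (rule PS.integrable_const_bound[of _ B]) (use Ry R_bound in simp_all)
    from PS.integral_fst'[OF this] show ?thesis by simp
  qed
  finally have 1: "(\<integral>s. (\<integral>p. K_ref p s \<partial>\<mu>) \<partial>?P) = (\<integral>a. R (y_ref (fst a) (snd a)) \<partial>(?P \<Otimes>\<^sub>M ?S))" .
  have "expected_J_dec G i \<mu> (env_law G N \<gamma>) = (\<integral>z. R z \<partial>env_law G N \<gamma>)"
    by (simp add: expected_J_dec_def R_def)
  also have "\<dots> = (\<integral>a. R (case a of (s, \<omega>) \<Rightarrow> \<lambda>t\<in>\<T>. y_path G N s \<omega> t) \<partial>(?P \<Otimes>\<^sub>M ?S))"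
    unfolding env_law_def
  proof (rule integral_distr)
    have "(\<lambda>a. if t \<in> \<T> then y_path G N (fst a) (snd a) t else undefined) \<in> borel_measurable (?P
      \<Otimes>\<^sub>M ?S)" for t
      using y[of t] by (cases "t \<in> \<T>") simp_all
    then have "(\<lambda>a. \<lambda>t\<in>\<T>. y_path G N (fst a) (snd a) t) \<in> borel_measurable (?P \<Otimes>\<^sub>M ?S)"
      unfolding restrict_def by (intro measurable_coordinatewise_then_product)
    then show "(\<lambda>(s, \<omega>). \<lambda>t\<in>\<T>. y_path G N s \<omega> t) \<in> ?P \<Otimes>\<^sub>M ?S \<rightarrow>\<^sub>M restrict_space borel (\<T> \<rightarrow>\<^sub>E UNIV)"
      by (intro measurable_restrict_space2) (auto simp: case_prod_beta')
    show "R \<in> borel_measurable (restrict_space borel (\<T> \<rightarrow>\<^sub>E UNIV))"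
      by (rule R_meas) (intro measurable_restrict_space1 measurable_product_coordinates)
  qed
  \<comment> \<open>The cut-off in \<open>env_law\<close> is invisible to \<open>R\<close>.\<close>
  also have "\<dots> = (\<integral>a. R (y_path G N (fst a) (snd a)) \<partial>(?P \<Otimes>\<^sub>M ?S))"
    by (simp add: R_def J_dec_restrict case_prod_beta')
  finally have 2: "expected_J_dec G i \<mu> (env_law G N \<gamma>) =
    (\<integral>a. R (y_path G N (fst a) (snd a)) \<partial>(?P \<Otimes>\<^sub>M ?S))" .
  have "\<bar>R (y_ref (fst a) (snd a)) - R (y_path G N (fst a) (snd a))\<bar> \<le>
    \<eta>" if a: "a \<in> space (?P \<Otimes>\<^sub>M ?S)" for a
    unfolding R_def
  proof (rule \<mu>.integral_close[OF _ _ J_dec_bound J_dec_bound])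
    fix p assume "p \<in> space \<mu>"
    then have p: "p \<in> pure_strategies G i" by (simp add: mixed_space[OF \<mu>])
    have s: "\<And>j. j \<in> {1..N} \<Longrightarrow> fst a j \<in> pure_strategies G j"
      using a profile_space[OF \<gamma>] by (auto simp: space_pair_measure)
    show "\<bar>J_dec G i p (y_ref (fst a) (snd a)) - J_dec G i p (y_path G N (fst a) (snd a))\<bar> \<le> \<eta>"
      unfolding J_dec_eq
    proof (rule S.integral_close[OF _ _ dec_cost_bound dec_cost_bound])
      show "\<bar>dec_cost i p (y_ref (fst a) (snd a)) \<omega> - dec_cost i p (y_path G N (fst a) (snd a)) \<omega>\<bar>
        \<le> \<eta>" for \<omega>
        using admissible_close[OF s p] by (simp add: abs_minus_commute)
    qed (rule dec_cost_fixed_measurable)+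
  qed (intro J_dec_measurable[OF i1] borel_measurable_const strat)+
  then show ?thesis
    unfolding 1 2 by (intro PS.integral_close[OF Ry(2,1) R_bound R_bound])
qed

lemma game_dec_close:
  "\<bar>expected_J_game G N i (\<gamma>(i := \<mu>)) - expected_J_dec G i \<mu> (env_law G N \<gamma>)\<bar> \<le> 2 * \<eta>"
  using game_K_ref K_ref_env_law unfolding K_ref_swap by linarith

end

theorem eventually_eps_Nash:
  assumes "\<epsilon> > 0"
  shows "\<forall>\<^sub>F N in sequentially. \<forall>\<gamma>. is_SEBEU G N \<gamma> \<longrightarrow> is_eps_Nash \<epsilon> G N \<gamma>"
proof -
  from cost_bounded obtain B where B: "\<And>i x u y. i \<ge> 1 \<Longrightarrow> \<bar>discounted_cost G i x u y\<bar> \<le> B" by blast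
  \<comment> \<open>\<open>game_dec_close\<close> loses \<open>2 * \<eta>\<close> and is applied
    twice, to the equilibrium strategy and to the deviation, so \<open>\<eta>\<close> is a quarter
    of \<epsilon>.\<close>
  have "\<epsilon> / 4 > 0" using assms by simp
  show ?thesis
    using game_cost_close[OF \<open>\<epsilon> / 4 > 0\<close>]
  proof eventually_elim
    case (elim N)
    show ?case
      unfolding is_eps_Nash_def
    proof (intro allI impI conjI ballI)
      fix \<gamma> i assume eq: "is_SEBEU G N \<gamma>" and i: "i \<in> {1..N}"
      then show \<gamma>i: "\<gamma> i \<in> mixed_strategies G i" by (simp add: is_SEBEU_def)
      fix \<gamma>' assume \<gamma>': "\<gamma>' \<in> mixed_strategies G i"
      have \<gamma>: "\<And>j. j \<in> {1..N} \<Longrightarrow> \<gamma> j \<in> mixed_strategies G j" using eq by (simp add: is_SEBEU_def)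
      have close: "\<bar>expected_J_game G N i (\<gamma>(i := \<mu>)) - expected_J_dec G i \<mu> (env_law G N \<gamma>)\<bar> \<le>
        2 * (\<epsilon> / 4)"
        if "\<mu> \<in> mixed_strategies G i" for \<mu>
        by (rule game_dec_close[OF \<gamma> i that, of B]) (use B elim i in \<open>auto simp: dec_cost_def\<close>)
      have "expected_J_dec G i (\<gamma> i) (env_law G N \<gamma>) \<le> expected_J_dec G i \<gamma>' (env_law G N \<gamma>)"
        using eq i \<gamma>' by (simp add: is_SEBEU_def)
      \<comment> \<open>The equilibrium is the case where \<open>\<mu>\<close> is
        \<open>\<gamma> i\<close> itself, for which the update of \<open>\<gamma>\<close> is
        trivial.\<close>
      with close[OF \<gamma>i] close[OF \<gamma>'] show "expected_J_game G N i \<gamma> \<le> expected_J_game G N i (\<gamma>(i :=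
        \<gamma>')) + \<epsilon>"
        unfolding fun_upd_triv by linarith
    qed
  qed
qed

end

theorem theorem4p1:
  fixes G :: "('x::compact_metric_space, 'u::compact_metric_space, 'w::compact_metric_space,
    'y::compact_metric_space, 'v::compact_metric_space, 'r::compact_metric_space,
    'q::compact_metric_space, 'd::compact_metric_space, 'o) game_seq"
    and \<epsilon> :: real
  assumes "game_setting G"
    and "condition_A1 G"
    and "condition_A2 G"
    and "condition_A3 G"
    and "\<epsilon> > 0"
  shows "\<exists>N\<^sub>\<epsilon>\<ge>1. \<forall>N\<ge>N\<^sub>\<epsilon>. \<forall>\<gamma>. is_SEBEU G N \<gamma> \<longrightarrow> is_eps_Nash \<epsilon> G N \<gamma>"
proof -
  interpret game_sequence G by standard (fact assms)+
  obtain M where "\<forall>N\<ge>M. \<forall>\<gamma>. is_SEBEU G N \<gamma> \<longrightarrow> is_eps_Nash \<epsilon> G N \<gamma>"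
    using eventually_eps_Nash[OF assms(5)] unfolding eventually_sequentially by blast
  then show ?thesis by (intro exI[of _ "max 1 M"]) auto
qed

end
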